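(* We have $M(7)=4$.
   Context: For a positive integer $n$, $\Phi_n(x)=\sum_{i=0}^{\phi(n)}c_i x^i$ denotes the $n$th cyclotomic polynomial ($\phi$ is Euler's totient function), and $A(n)=\max\{|c_i| : 0\leqslant i\leqslant \phi(n)\}$ is the largest absolute value of its coefficients. For a fixed odd prime $p$, $M(p)=\max\{A(pqr) : q, r \text{ primes with } p<q<r\}$. *)

theory Defs
  imports Complex_Main
    "HOL-Computational_Algebra.Polynomial"
    "HOL-Number_Theory.Totient"
begin

definition primitive_roots_of_unity :: "nat \<Rightarrow> complex set" where
  "primitive_roots_of_unity n = {z. z ^ n = 1 \<and> (\<forall>m. 0 < m \<and> m < n \<longrightarrow> z ^ m \<noteq> 1)}"

(* Only meaningful for n > 0. *)
definition cyclotomic_poly :: "nat \<Rightarrow> complex poly" where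
  "cyclotomic_poly n = (\<Prod>z\<in>primitive_roots_of_unity n. [:- z, 1:])"

(* The coefficients are integers, regarded here as complex numbers; the height
   is therefore a real number with integer value. *)
definition cyclotomic_height :: "nat \<Rightarrow> real" where
  "cyclotomic_height n = Max {cmod (coeff (cyclotomic_poly n) i) | i. i \<le> totient n}"

definition ternary_heights :: "nat \<Rightarrow> real set" where
  "ternary_heights p =
     {cyclotomic_height (p * q * r) | q r. prime q \<and> prime r \<and> p < q \<and> q < r}"

(* The set ranges over infinitely many pairs (q, r), and Max is unspecified on
   infinite sets: the value is the maximum only if ternary_heights p is finite. *)
definition max_ternary_height :: "nat \<Rightarrow> real" where
  "max_ternary_height p = Max (ternary_heights p)"

end

theory Submission
  imports Defs "HOL-Computational_Algebra.Fundamental_Theorem_Algebra"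
begin

text \<open>
  Let \<open>N = 7 q r\<close>. By the product formula for the cyclotomic polynomial, its coefficient of index
  \<open>n\<close> is a sum, over the seven integers \<open>m\<close> of the window from \<open>n - 6\<close> to \<open>n\<close>, of
  \<open>c m - c (m - q) - c (m - r) + c (m - q - r)\<close>, where \<open>c m\<close> is 1 if \<open>m\<close> is a combination
  \<open>x q r + 7 Y r + 7 Z q\<close> with nonnegative coefficients below 7, \<open>q\<close> and \<open>r\<close>, and 0 otherwise
  (\<open>coeff_cyclotomic_poly_three_primes\<close>). By the Chinese remainder theorem every integer \<open>m\<close> has
  unique digits \<open>x\<close>, \<open>Y\<close>, \<open>Z\<close> for which the combination is \<open>m + N e\<close> with an integer carry \<open>e\<close>,
  and \<open>c m = 1\<close> means \<open>e = 0\<close>. Shifting \<open>m\<close> by \<open>q\<close> or \<open>r\<close> changes \<open>e\<close> by an amount that only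
  depends on \<open>x\<close> and on whether \<open>Y / q\<close> and \<open>Z / r\<close> are below \<open>1 - s / 7\<close> and \<open>1 - t / 7\<close>, where
  \<open>s\<close> and \<open>t\<close> are the inverses of \<open>q\<close> and \<open>r\<close> modulo 7 (\<open>e_minus_r\<close>).

  The seven integers of a window have different digits \<open>x\<close>, and \<open>x / 7 + Y / q + Z / r\<close> is
  constant modulo 1 up to a harmless drift. Hence the coefficient is a sum of seven terms, one for
  each \<open>x\<close>, and it can be studied with real coordinates on the circle (\<open>phase_window\<close>). Assume
  \<open>s \<le> t\<close>. Every term is -1, 0 or 1, with a sign that depends on the range of \<open>x\<close> only, and
  counting the digits in these ranges leaves ten cases \<open>(s, t, sign)\<close> in which more than four
  terms might add up. A nonzero term confines \<open>Y / q + Z / r\<close>, and therefore \<open>x\<close>, to a short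
  range, which settles seven of them. The last three are \<open>(2, 2)\<close> and \<open>(5, 5)\<close> with positive and
  \<open>(2, 5)\<close> with negative sign. They use that the numbers \<open>Y / q\<close> and \<open>Z / r\<close> run through
  arithmetic progressions on the circle while \<open>m\<close> runs through the window: three digits whose
  points must lie in an arc of length 2/7 leave no room for the conditions on the other two
  digits.

  The bound is attained by the coefficient of index 875 for \<open>q = 17\<close> and \<open>r = 23\<close>.
\<close>

section \<open>Cyclotomic polynomials of products of three primes\<close>

definition roots_of_unity :: "nat \<Rightarrow> complex set" where
  "roots_of_unity n = {z. z ^ n = 1}"

lemma finite_roots_of_unity: "n > 0 \<Longrightarrow> finite (roots_of_unity n)"
  unfolding roots_of_unity_def by (rule finite_roots_unity) simp

lemma prod_roots_of_unity:
  assumes "n > 0"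
  shows "(\<Prod>z\<in>roots_of_unity n. [:- z, 1:]) = monom 1 n - 1"
proof -
  let ?p = "monom 1 n - 1 :: complex poly"
  have deg: "degree ?p = n"
    using assms degree_add_eq_left[of "-1" "monom (1::complex) n"] by (simp add: degree_monom_eq)
  hence "coeff ?p n = 1" using assms by simp
  have lead: "lead_coeff ?p = 1" unfolding deg using assms by simp
  have "rsquarefree ?p"
    unfolding rsquarefree_roots
  proof (intro allI notI, elim conjE)
    fix a assume a: "poly ?p a = 0" "poly (pderiv ?p) a = 0"
    hence "a ^ n = 1" "of_nat n * a ^ (n - 1) = 0"
      by (simp_all add: poly_monom pderiv_diff pderiv_monom)
    thus False using assms by (auto simp: power_0_left)
  qed
  hence "smult (lead_coeff ?p) (\<Prod>z | poly ?p z = 0. [:- z, 1:]) = ?p"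
    by (rule complex_poly_decompose_rsquarefree)
  moreover have "{z. poly ?p z = 0} = roots_of_unity n"
    by (simp add: roots_of_unity_def poly_monom)
  ultimately show ?thesis using lead by simp
qed

lemma root_of_unity_gcd:
  assumes "z ^ a = (1::complex)" "z ^ b = 1"
  shows "z ^ gcd a b = 1"
proof (cases "a = 0")
  case False
  then obtain x y where "a * x = b * y + gcd a b" using bezout_nat by blast
  hence "z ^ (a * x) = z ^ (b * y) * z ^ gcd a b" by (simp add: power_add)
  thus ?thesis using assms by (simp add: power_mult)
qed (use assms in simp)

lemma root_of_unity_dvd: "z ^ a = (1::complex) \<Longrightarrow> a dvd b \<Longrightarrow> z ^ b = 1"
  by (auto simp: dvd_def power_mult)

lemma roots_of_unity_Int: "roots_of_unity a \<inter> roots_of_unity b = roots_of_unity (gcd a b)"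
  unfolding roots_of_unity_def by (auto intro: root_of_unity_gcd root_of_unity_dvd)

text \<open>
  A root of unity whose order properly divides \<open>p q r\<close> misses one of the three primes in its
  order, so it is already a root of unity of order \<open>p q\<close>, \<open>p r\<close> or \<open>q r\<close>.
\<close>

lemma primitive_roots_of_unity_three_primes:
  assumes "prime p" "prime q" "prime r"
  shows "primitive_roots_of_unity (p * q * r) = roots_of_unity (p * q * r) -
    (roots_of_unity (p * q) \<union> roots_of_unity (p * r) \<union> roots_of_unity (q * r))" (is "?L = ?R")
proof (intro equalityI subsetI)
  fix z assume z: "z \<in> ?L"
  have pos: "p > 1" "q > 1" "r > 1" using assms prime_gt_1_nat by blast+
  have "p * q < p * q * r" "p * r < p * q * r" "q * r < p * q * r"
    using pos by (simp_all add: mult.commute mult.left_commute)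
  thus "z \<in> ?R" using z pos by (auto simp: primitive_roots_of_unity_def roots_of_unity_def)
next
  fix z assume z: "z \<in> ?R"
  have pos: "p * q * r > 0" using assms by (auto intro: prime_gt_0_nat)
  have "z ^ m \<noteq> 1" if m: "0 < m" "m < p * q * r" for m
  proof
    assume "z ^ m = 1"
    define g where "g = gcd m (p * q * r)"
    have g: "z ^ g = 1" unfolding g_def using z \<open>z ^ m = 1\<close>
      by (intro root_of_unity_gcd) (auto simp: roots_of_unity_def)
    have "g dvd p * q * r" by (simp add: g_def)
    then obtain k where k: "p * q * r = g * k" by (auto simp: dvd_def)
    have "g \<le> m" using m by (simp add: g_def gcd_le1_nat)
    hence "k \<noteq> 1" using k m by auto
    then obtain l where l: "prime l" "l dvd k" using prime_factor_nat by blast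
    have "l dvd p * q * r" using l k by auto
    hence "l dvd p \<or> l dvd q \<or> l dvd r" using l by (simp add: prime_dvd_mult_iff)
    hence "l = p \<or> l = q \<or> l = r" using l assms by (auto dest: primes_dvd_imp_eq)
    moreover obtain h where h: "k = l * h" using l by (auto simp: dvd_def)
    moreover have "l > 0" using l by (auto intro: prime_gt_0_nat)
    moreover note k
    ultimately have "g dvd q * r \<or> g dvd p * r \<or> g dvd p * q" by (auto simp: dvd_def mult_ac)
    thus False using root_of_unity_dvd[OF g] z by (auto simp: roots_of_unity_def)
  qed
  thus "z \<in> ?L" using z by (auto simp: primitive_roots_of_unity_def roots_of_unity_def)
qed

text \<open>
  This is the Moebius product formula for three primes, multiplied out. It is inclusion-exclusion
  for the union of the three groups of roots of unity removed above: products of linear factors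
  turn unions and intersections of sets into products, and intersecting groups of roots of unity
  takes the gcd of the exponents.
\<close>

lemma cyclotomic_poly_three_primes:
  assumes "prime p" "prime q" "prime r" "p \<noteq> q" "p \<noteq> r" "q \<noteq> r"
  shows "cyclotomic_poly (p * q * r) * (monom 1 (p * q) - 1) * (monom 1 (p * r) - 1) *
      (monom 1 (q * r) - 1) * (monom 1 1 - 1) =
    (monom 1 (p * q * r) - 1) * (monom 1 p - 1) * (monom 1 q - 1) * (monom 1 r - 1)"
proof -
  define P where "P A = (\<Prod>z\<in>A. [:- z, 1:])" for A :: "complex set"
  let ?U = roots_of_unity
  have pos: "p > 0" "q > 0" "r > 0" using assms by (auto intro: prime_gt_0_nat)
  have cop: "coprime p q" "coprime p r" "coprime q r" using assms by (auto intro: primes_coprime)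
  have fin: "finite (?U p)" "finite (?U q)" "finite (?U r)" "finite (?U (p * q))" "finite (?U (p * r))"
    "finite (?U (q * r))" "finite (?U (p * q * r))" "finite (?U 1)"
    using pos by (auto intro!: finite_roots_of_unity)
  have PU: "P (?U n) = monom 1 n - 1" if "n > 0" for n
    unfolding P_def by (rule prod_roots_of_unity[OF that])
  have un: "P (A \<union> B) * P (A \<inter> B) = P A * P B" if "finite A" "finite B" for A B
    unfolding P_def by (rule prod.union_inter[OF that])
  have gcds: "gcd (p * q) (p * r) = p" "gcd (p * q) (q * r) = q" "gcd (p * r) (q * r) = r" "gcd q r = 1"
    using cop gcd_mult_distrib_nat[of p q r] gcd_mult_distrib_nat[of q p r]
      gcd_mult_distrib_nat[of r p q] by (simp_all add: mult.commute)
  \<comment> \<open>The non-primitive roots; the next three facts express the product over them by the groups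
    alone.\<close>
  define W where "W = ?U (p * q) \<union> ?U (p * r) \<union> ?U (q * r)"
  have W1: "P W * P (?U q \<union> ?U r) = P (?U (p * q) \<union> ?U (p * r)) * P (?U (q * r))"
    using un[of "?U (p * q) \<union> ?U (p * r)" "?U (q * r)"] fin
    by (simp add: W_def Int_Un_distrib2 roots_of_unity_Int gcds)
  have W2: "P (?U (p * q) \<union> ?U (p * r)) * P (?U p) = P (?U (p * q)) * P (?U (p * r))"
    using un[of "?U (p * q)" "?U (p * r)"] fin by (simp add: roots_of_unity_Int gcds)
  have W3: "P (?U q \<union> ?U r) * P (?U 1) = P (?U q) * P (?U r)"
    using un[of "?U q" "?U r"] fin by (simp add: roots_of_unity_Int gcds)
  have "W \<subseteq> ?U (p * q * r)" unfolding W_def roots_of_unity_def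
    by (auto intro: root_of_unity_dvd)
  hence \<Phi>: "cyclotomic_poly (p * q * r) * P W = P (?U (p * q * r))"
    unfolding cyclotomic_poly_def primitive_roots_of_unity_three_primes[OF assms(1-3)] W_def[symmetric] P_def
    using fin by (metis prod.subset_diff)
  have nz: "P W \<noteq> 0" "P (?U q \<union> ?U r) \<noteq> 0" "P (?U (p * q) \<union> ?U (p * r)) \<noteq> 0"
    using fin by (simp_all add: P_def W_def)
  have "P (?U q \<union> ?U r) * P W * (cyclotomic_poly (p * q * r) * P (?U (p * q)) * P (?U (p * r)) * P (?U (q * r))
    * P (?U 1))
    = P (?U q \<union> ?U r) * P W * (P (?U (p * q * r)) * P (?U p) * P (?U q) * P (?U r))"
    using W1 W2 W3 \<Phi> by algebra
  thus ?thesis using nz pos by (simp add: PU)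
qed

section \<open>Coefficients as counts of representations\<close>

lemma monom_diff_geometric:
  "monom 1 (d * k) - 1 = (monom 1 d - 1) * (\<Sum>i<k. monom (1::complex) (d * i))"
  using power_diff_1_eq[of "monom (1::complex) d" k] by (simp add: monom_power)

text \<open>
  The coefficient of \<open>X\<^sup>m\<close> in \<open>(X\<^sup>N - 1)\<^sup>3 / ((X\<^bsup>q r\<^esup> - 1) (X\<^bsup>p r\<^esup> - 1) (X\<^bsup>p q\<^esup> - 1))\<close> for
  \<open>N = p q r\<close>. The argument is an integer because the coefficient formula below evaluates it at
  shifted, possibly negative, arguments.
\<close>

definition num_reps :: "nat \<Rightarrow> nat \<Rightarrow> nat \<Rightarrow> int \<Rightarrow> nat" where
  "num_reps p q r m = card {(a, b, c) \<in> {..<p} \<times> {..<q} \<times> {..<r}. int (a * (q * r) + b * (p * r) + c * (p * q))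
    = m}"

lemma coeff_prod_geometric:
  "coeff (monom 1 k * ((\<Sum>a<p. monom 1 (q * r * a)) * (\<Sum>b<q. monom 1 (p * r * b)) * (\<Sum>c<r. monom 1 (p * q * c)))) i
    = (of_nat (num_reps p q r (int i - int k)) :: complex)"
proof -
  let ?B = "{..<p} \<times> {..<q} \<times> {..<r}"
  let ?F = "\<lambda>(a, b, c). a * (q * r) + b * (p * r) + c * (p * q)"
  have "(\<Sum>a<p. monom 1 (q * r * a)) * (\<Sum>b<q. monom 1 (p * r * b)) * (\<Sum>c<r. monom (1::complex) (p * q * c))
    = (\<Sum>a<p. \<Sum>b<q. \<Sum>c<r. monom 1 (?F (a, b, c)))"
    by (simp add: sum_product sum_distrib_left sum_distrib_right mult_monom mult_ac add_ac)
  also have "\<dots> = (\<Sum>x\<in>?B. monom 1 (?F x))"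
    by (simp add: sum.cartesian_product split_def)
  finally have "coeff (monom 1 k * ((\<Sum>a<p. monom 1 (q * r * a)) * (\<Sum>b<q. monom 1 (p * r * b)) * (\<Sum>c<r. monom 1
    (p * q * c)))) i
    = (\<Sum>x\<in>?B. if k + ?F x = i then 1 else (0::complex))"
    by (simp add: sum_distrib_left mult_monom coeff_sum)
  also have "\<dots> = of_nat (card {x \<in> ?B. k + ?F x = i})"
    by (simp add: sum.If_cases Int_def)
  also have "{x \<in> ?B. k + ?F x = i} = {x \<in> ?B. int (?F x) = int i - int k}"
    by (intro Collect_cong conj_cong refl) linarith
  also have "\<dots> = {(a, b, c) \<in> ?B. int (a * (q * r) + b * (p * r) + c * (p * q)) = int i - int k}"
    by auto
  finally show ?thesis by (simp only: num_reps_def)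
qed

text \<open>
  Multiplying the product formula by \<open>(X\<^sup>N - 1)\<^sup>2\<close>, where \<open>N = p q r\<close>, makes every division exact,
  and it does not change the coefficients below \<open>N\<close>. What remains is
  \<open>(1 + X + \<dots> + X\<^bsup>p-1\<^esup>) (X\<^sup>q - 1) (X\<^sup>r - 1)\<close> times the generating polynomial of \<open>num_reps\<close>, which
  explains the window of length \<open>p\<close> and the four signs.
\<close>

lemma coeff_cyclotomic_poly_three_primes:
  assumes "prime p" "prime q" "prime r" "p \<noteq> q" "p \<noteq> r" "q \<noteq> r" "i < p * q * r"
  defines "c \<equiv> \<lambda>m. int (num_reps p q r m)"
  shows "coeff (cyclotomic_poly (p * q * r)) i =
    of_int (\<Sum>j<p. c (int i - int j) - c (int i - int j - int q) - c (int i - int j - int r)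
      + c (int i - int j - int q - int r))"
proof -
  let ?X = "monom (1::complex)" and ?\<Phi> = "cyclotomic_poly (p * q * r)"
  define M where "M n = ?X n - 1" for n
  define A where "A = (\<Sum>a<p. ?X (q * r * a))"
  define B where "B = (\<Sum>b<q. ?X (p * r * b))"
  define C where "C = (\<Sum>c<r. ?X (p * q * c))"
  define G where "G = (\<Sum>j<p. ?X j)"
  have pos: "p > 0" "q > 0" "r > 0" using assms by (auto intro: prime_gt_0_nat)
  have nz: "M n \<noteq> 0" if "n > 0" for n
  proof
    assume "M n = 0"
    hence "coeff (?X n) n = coeff 1 n" by (simp add: M_def)
    thus False using that by simp
  qed
  have N: "M (p * q * r) = M (q * r) * A" "M (p * q * r) = M (p * r) * B" "M (p * q * r) = M (p * q) * C"
    "M p = M 1 * G"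
    unfolding M_def A_def B_def C_def G_def
    using monom_diff_geometric[of "q * r" p] monom_diff_geometric[of "p * r" q]
      monom_diff_geometric[of "p * q" r] monom_diff_geometric[of 1 p] by (simp_all add: mult_ac)
  have "?\<Phi> * M (p * q) * M (p * r) * M (q * r) * M 1 = M (p * q * r) * M p * M q * M r"
    using cyclotomic_poly_three_primes[OF assms(1-6)] unfolding M_def .
  hence "M (p * q * r) * M 1 * (?\<Phi> * M (p * q * r) * M (p * q * r)) = M (p * q * r) * M 1 * (G * M q * M r * (A
    * B * C))"
    using N by algebra
  hence eq: "?\<Phi> * M (p * q * r) * M (p * q * r) = G * M q * M r * (A * B * C)"
    using nz pos by simp
  have "?\<Phi> * M (p * q * r) * M (p * q * r) = ?\<Phi> + ?X (p * q * r) * (?\<Phi> * (?X (p * q * r) - 2))"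
    unfolding M_def by algebra
  hence "coeff ?\<Phi> i = coeff (?\<Phi> * M (p * q * r) * M (p * q * r)) i"
    using assms(7) by (simp add: coeff_monom_mult)
  also have "?\<Phi> * M (p * q * r) * M (p * q * r) = (\<Sum>j<p. ?X j * (A * B * C) - ?X (j + q) * (A * B * C)
      - ?X (j + r) * (A * B * C) + ?X (j + q + r) * (A * B * C))"
  proof -
    have "G * M q * M r * (A * B * C) = (\<Sum>j<p. ?X j * (M q * M r * (A * B * C)))"
      by (simp add: G_def sum_distrib_right mult.assoc)
    also have "\<dots> = (\<Sum>j<p. ?X j * (A * B * C) - ?X (j + q) * (A * B * C)
      - ?X (j + r) * (A * B * C) + ?X (j + q + r) * (A * B * C))"
    proof (rule sum.cong)
      fix j
      have "?X (j + q) = ?X j * ?X q" "?X (j + r) = ?X j * ?X r" "?X (j + q + r) = ?X j * ?X q * ?X r"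
        by (simp_all add: mult_monom)
      thus "?X j * (M q * M r * (A * B * C)) = ?X j * (A * B * C) - ?X (j + q) * (A * B * C)
        - ?X (j + r) * (A * B * C) + ?X (j + q + r) * (A * B * C)"
        unfolding M_def by algebra
    qed simp
    finally show ?thesis using eq by simp
  qed
  also have "coeff \<dots> i = of_int (\<Sum>j<p. c (int i - int j) - c (int i - int j - int q) - c (int i - int j - int r)
      + c (int i - int j - int q - int r))"
  proof -
    have "coeff (?X k * (A * B * C)) i = of_int (c (int i - int k))" for k
      unfolding A_def B_def C_def c_def coeff_prod_geometric by simp
    thus ?thesis by (simp add: coeff_sum diff_diff_eq add.assoc)
  qed
  finally show ?thesis .
qed

text \<open>
  Chinese remaindering: each coefficient of a representation of \<open>m\<close> is determined by \<open>m\<close> modulo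
  one of \<open>p\<close>, \<open>q\<close>, \<open>r\<close>, so there is one candidate only, and it either represents \<open>m\<close> or differs
  from it by a nonzero multiple of \<open>p q r\<close>.
\<close>

lemma num_reps_eq:
  assumes "p > 0" "q > 0" "r > 0"
    and "[u * (int q * int r) = 1] (mod int p)" "[v * (int p * int r) = 1] (mod int q)"
      "[w * (int p * int q) = 1] (mod int r)"
  shows "num_reps p q r m = of_bool ((m * u) mod int p * (int q * int r) + (m * v) mod int q * (int p * int r)
      + (m * w) mod int r * (int p * int q) = m)" (is "_ = of_bool ?P")
proof -
  let ?S = "{(a, b, c) \<in> {..<p} \<times> {..<q} \<times> {..<r}. int (a * (q * r) + b * (p * r) + c * (p * q)) = m}"
  let ?a = "(m * u) mod int p" and ?b = "(m * v) mod int q" and ?c = "(m * w) mod int r"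
  note pos = assms(1-3)
  have digit: "int x = (m * k) mod int l"
    if "m = int x * n + int l * d" "[k * n = 1] (mod int l)" "x < l" for x l :: nat and n k d :: int
  proof -
    have "[m * k = int x * (k * n) + int l * (d * k)] (mod int l)"
      unfolding that(1) by (simp add: algebra_simps)
    also have "[int x * (k * n) + int l * (d * k) = int x * 1 + 0] (mod int l)"
      by (intro cong_add cong_mult cong_refl that(2)) (simp add: cong_0_iff)
    finally show ?thesis using that(3) by (simp add: cong_def)
  qed
  have "?S = (if ?P then {(nat ?a, nat ?b, nat ?c)} else {})"
  proof -
    have "int a = ?a \<and> int b = ?b \<and> int c = ?c" if "(a, b, c) \<in> ?S" for a b c
    proof -
      have m: "m = int a * (int q * int r) + int p * (int b * int r + int c * int q)"
        "m = int b * (int p * int r) + int q * (int a * int r + int c * int p)"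
        "m = int c * (int p * int q) + int r * (int a * int q + int b * int p)"
        using that by (auto simp: algebra_simps)
      show ?thesis
        using digit[OF m(1) assms(4)] digit[OF m(2) assms(5)] digit[OF m(3) assms(6)] that by auto
    qed
    moreover have "(nat ?a, nat ?b, nat ?c) \<in> {..<p} \<times> {..<q} \<times> {..<r}"
      using pos by (auto simp: nat_less_iff)
    moreover have "int (nat ?a) = ?a" "int (nat ?b) = ?b" "int (nat ?c) = ?c"
      using pos by auto
    ultimately show ?thesis by (auto split: if_splits)
  qed
  thus ?thesis by (simp add: num_reps_def)
qed

text \<open>
  The witness for the lower bound. The constants 6, 15, 6 are the inverses of \<open>17 * 23\<close>, \<open>7 * 23\<close>
  and \<open>7 * 17\<close> modulo 7, 17 and 23.
\<close>

lemma coeff_example: "coeff (cyclotomic_poly (7 * 17 * 23)) 875 = 4"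
proof -
  have c: "int (num_reps 7 17 23 m) = of_bool ((m * 6) mod 7 * 391 + (m * 15) mod 17 * 161 + (m * 6) mod 23
    * 119 = m)" for m
    using num_reps_eq[of 7 17 23 6 15 6 m] by (simp add: cong_def)
  show ?thesis
    using coeff_cyclotomic_poly_three_primes[of 7 17 23 875]
    by (simp add: c lessThan_nat_numeral lessThan_Suc)
qed

section \<open>Points on the circle in a window of seven digits\<close>

lemma Ints_eq_0: "(a::real) \<in> \<int> \<Longrightarrow> -1 < a \<Longrightarrow> a < 1 \<Longrightarrow> a = 0"
  by (auto elim!: Ints_cases)

lemma Ints_eq_1: "(a::real) \<in> \<int> \<Longrightarrow> 0 < a \<Longrightarrow> a < 2 \<Longrightarrow> a = 1"
  using Ints_eq_0[of "a - 1"] by auto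

text \<open>
  A step whose double and triple are both shorter than 2/7 of a turn is either nearly 0, or it
  lies between a third and half of a turn: then its triple is a little more and its double a
  little less than a full turn.
\<close>

lemma narrow_step:
  fixes \<delta> :: real
  assumes "3 * \<delta> - u \<in> \<int>" "\<bar>u\<bar> < 2/7" "2 * \<delta> - v \<in> \<int>" "\<bar>v\<bar> < 2/7"
  shows "\<exists>d. \<delta> - d \<in> \<int> \<and> (\<bar>d\<bar> < 2/21 \<or> (5/14 < \<bar>d\<bar> \<and> \<bar>d\<bar> < 3/7))"
proof -
  obtain a where a: "3 * \<delta> - u = of_int a" using assms(1) by (auto elim: Ints_cases)
  obtain b where b: "2 * \<delta> - v = of_int b" using assms(3) by (auto elim: Ints_cases)
  have "real_of_int (2 * a - 3 * b) = 3 * v - 2 * u" using a b by simp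
  hence "real_of_int (2 * a - 3 * b) < 2" "real_of_int (2 * a - 3 * b) > -2"
    using assms(2,4) by linarith+
  hence "2 * a - 3 * b = 0 \<or> 2 * a - 3 * b = 1 \<or> 2 * a - 3 * b = -1" by linarith
  thus ?thesis
  proof (elim disjE)
    assume *: "2 * a - 3 * b = 0"
    have "b = 2 * (a - b)" using * by simp
    hence "real_of_int b = 2 * real_of_int (a - b)" by (metis of_int_mult of_int_numeral)
    hence "\<bar>\<delta> - of_int (a - b)\<bar> < 2/21" using a b * assms(2) by linarith
    thus ?thesis by (intro exI[of _ "\<delta> - of_int (a - b)"]) simp
  next
    assume *: "2 * a - 3 * b = 1"
    have "b = 2 * (a - b) - 1" using * by simp
    hence "real_of_int b = 2 * real_of_int (a - b) - 1" by linarith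
    hence "5/14 < \<bar>\<delta> - of_int (a - b)\<bar>" "\<bar>\<delta> - of_int (a - b)\<bar> < 3/7"
      using a b * assms(2,4) by linarith+
    thus ?thesis by (intro exI[of _ "\<delta> - of_int (a - b)"]) simp
  next
    assume *: "2 * a - 3 * b = -1"
    have "b = 2 * (a - b) + 1" using * by simp
    hence "real_of_int b = 2 * real_of_int (a - b) + 1" by linarith
    hence "5/14 < \<bar>\<delta> - of_int (a - b)\<bar>" "\<bar>\<delta> - of_int (a - b)\<bar> < 3/7"
      using a b * assms(2,4) by linarith+
    thus ?thesis by (intro exI[of _ "\<delta> - of_int (a - b)"]) simp
  qed
qed

text \<open>
  Two such steps add up to 3/7 of a turn only if one is short and the other just below 3/7: modulo
  1, the sum of two short steps, of two long ones, or of a short and a long backward one misses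
  3/7.
\<close>

lemma narrow_steps:
  fixes \<delta> \<epsilon> :: real
  assumes "3 * \<delta> - u \<in> \<int>" "\<bar>u\<bar> < 2/7" "2 * \<delta> - v \<in> \<int>" "\<bar>v\<bar> < 2/7"
    and "3 * \<epsilon> - u' \<in> \<int>" "\<bar>u'\<bar> < 2/7" "2 * \<epsilon> - v' \<in> \<int>" "\<bar>v'\<bar> < 2/7"
    and "\<delta> + \<epsilon> - 3/7 \<in> \<int>"
  obtains d where "0 < d" "d < 1/14" "\<delta> - d \<in> \<int>" "\<epsilon> - (3/7 - d) \<in> \<int>"
    | d where "0 < d" "d < 1/14" "\<epsilon> - d \<in> \<int>" "\<delta> - (3/7 - d) \<in> \<int>"
proof -
  obtain d where d: "\<delta> - d \<in> \<int>" "\<bar>d\<bar> < 2/21 \<or> (5/14 < \<bar>d\<bar> \<and> \<bar>d\<bar> < 3/7)"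
    using narrow_step[OF assms(1-4)] by blast
  obtain e where e: "\<epsilon> - e \<in> \<int>" "\<bar>e\<bar> < 2/21 \<or> (5/14 < \<bar>e\<bar> \<and> \<bar>e\<bar> < 3/7)"
    using narrow_step[OF assms(5-8)] by blast
  have "(\<delta> + \<epsilon> - 3/7) - (\<delta> - d) - (\<epsilon> - e) \<in> \<int>"
    by (rule Ints_diff[OF Ints_diff[OF assms(9) d(1)] e(1)])
  moreover have "(\<delta> + \<epsilon> - 3/7) - (\<delta> - d) - (\<epsilon> - e) = d + e - 3/7" by simp
  ultimately have "d + e - 3/7 \<in> \<int>" by argo
  then obtain k where k: "d + e - 3/7 = of_int k" by (auto elim: Ints_cases)
  have "real_of_int k < 1" "real_of_int k > -2" using k d(2) e(2) by linarith+
  hence "k = 0 \<or> k = -1" by linarith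
  moreover have "k \<noteq> -1" using k d(2) e(2) by (auto simp: abs_if split: if_splits)
  ultimately have de: "d + e = 3/7" using k by simp
  show ?thesis
  proof (cases "\<bar>d\<bar> < 2/21")
    case True
    hence "0 < d" "d < 1/14" using e(2) de by (auto simp: abs_if split: if_splits)
    moreover have "e = 3/7 - d" using de by simp
    ultimately show ?thesis using that(1)[of d] d(1) e(1) by simp
  next
    case False
    hence "0 < e" "e < 1/14" using d(2) e(2) de by (auto simp: abs_if split: if_splits)
    moreover have "d = 3/7 - e" using de by simp
    ultimately show ?thesis using that(2)[of e] d(1) e(1) by simp
  qed
qed

lemma Ints_shift_step:
  fixes a \<delta> d :: real
  assumes "a + of_int k * \<delta> \<in> \<int>" "\<delta> - d \<in> \<int>"
  shows "a + of_int k * d \<in> \<int>"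
proof -
  have "(a + of_int k * \<delta>) - of_int k * (\<delta> - d) \<in> \<int>"
    by (intro Ints_diff Ints_mult assms Ints_of_int)
  thus ?thesis by (simp add: algebra_simps)
qed

lemma Ints_midpoint:
  fixes a b c \<delta> :: real
  assumes "b - a + \<delta> \<in> \<int>" "c - b + \<delta> \<in> \<int>"
  shows "a + c - 2 * b \<in> \<int>"
  using Ints_diff[OF assms(2,1)] by (simp add: algebra_simps)

text \<open>
  The combinatorial core, freed from number theory. The seven integers of a window are indexed by
  their digit \<open>x \<in> {0..6}\<close> modulo 7. The reals \<open>y x\<close> and \<open>z x\<close> are the scaled digits modulo the
  two large primes, and \<open>e x\<close> is the carry, the integer part of the digit sum. The integer with
  digit \<open>x\<close> has position \<open>(n - x * \<kappa>) mod 7\<close> in the window; the last two assumptions say that,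
  listed by position, the points \<open>y x\<close> and \<open>z x\<close> form arithmetic progressions on the circle
  \<open>\<real> / \<int>\<close>. The parameters \<open>s\<close> and \<open>t\<close> are the inverses of the two large primes modulo 7.
\<close>

locale phase_window =
  fixes s t \<kappa> n :: int and \<theta> \<delta> \<epsilon> :: real and e :: "int \<Rightarrow> int" and y z :: "int \<Rightarrow> real"
  assumes st: "1 \<le> s" "s \<le> t" "t \<le> 6"
    and kappa: "(\<kappa> * s * t) mod 7 = 1"
    and \<theta>: "0 \<le> \<theta>" "\<theta> < 1"
    and y: "\<And>x. 0 \<le> y x" "\<And>x. y x < 1"
    and z: "\<And>x. 0 \<le> z x" "\<And>x. z x < 1"
    and sum: "\<And>x. x \<in> {0..6} \<Longrightarrow> x / 7 + y x + z x = e x + \<theta>"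
    and y_neq: "\<And>x. y x \<noteq> 1 - s / 7" and z_neq: "\<And>x. z x \<noteq> 1 - t / 7"
    and y_step: "\<And>x x'. y x - y x' + of_int ((n - x * \<kappa>) mod 7 - (n - x' * \<kappa>) mod 7) * \<delta> \<in> \<int>"
    and z_step: "\<And>x x'. z x - z x' + of_int ((n - x * \<kappa>) mod 7 - (n - x' * \<kappa>) mod 7) * \<epsilon> \<in> \<int>"
begin

text \<open>
  The four terms of the coefficient formula that belong to the digit \<open>x\<close>: a term counts if its
  carry vanishes, and the shifts by the two primes change the carry by the amounts written here.
\<close>

definition contribution :: "int \<Rightarrow> int" where
  "contribution x = of_bool (e x = 0) - of_bool (e x - 1 + of_bool (x < t) + of_bool (z x < 1 - t / 7) = 0)
    - of_bool (e x - 1 + of_bool (x < s) + of_bool (y x < 1 - s / 7) = 0)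
    + of_bool (e x - 2 + of_bool (x < t) + of_bool (z x < 1 - t / 7)
        + of_bool ((x - t) mod 7 < s) + of_bool (y x < 1 - s / 7) = 0)"

text \<open>
  A digit sum that is large enough forces a carry; these bounds exclude negative carries of the
  shifted terms.
\<close>

lemma e_bounds:
  assumes "x \<in> {0..6}"
  shows "e x \<ge> 0" "e x \<le> 2"
    "s \<le> x \<Longrightarrow> \<not> y x < 1 - s / 7 \<Longrightarrow> e x \<ge> 1"
    "t \<le> x \<Longrightarrow> \<not> z x < 1 - t / 7 \<Longrightarrow> e x \<ge> 1"
    "s + t - 7 \<le> x \<Longrightarrow> \<not> y x < 1 - s / 7 \<Longrightarrow> \<not> z x < 1 - t / 7 \<Longrightarrow> e x \<ge> 1"
    "s + t \<le> x \<Longrightarrow> \<not> y x < 1 - s / 7 \<Longrightarrow> \<not> z x < 1 - t / 7 \<Longrightarrow> e x \<ge> 2"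
  using sum[OF assms] y[of x] z[of x] y_neq[of x] z_neq[of x] \<theta> assms
  by (auto simp: field_simps)

text \<open>
  The digits split into ranges on which the contribution has constant sign. The following four
  lemmas also record what a nonzero contribution says about the carry and the position of \<open>y x\<close>
  and \<open>z x\<close> on the circle.
\<close>

lemma contribution_low:
  assumes "x \<in> {0..6}" "x < s"
  shows "contribution x \<in> {0, 1}"
    "contribution x = 1 \<Longrightarrow> e x = 0 \<or> (e x = 1 \<and> y x > 1 - s / 7 \<and> z x > 1 - t / 7)"
    "contribution x = 1 \<Longrightarrow> x < s + t - 7 \<Longrightarrow> e x = 0 \<and> y x < 1 - s / 7 \<and> z x < 1 - t / 7"
proof -
  have m: "(x - t) mod 7 = x - t + 7"
    using mod_pos_pos_trivial[of "x - t + 7" 7] assms st by auto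
  have gt: "y x > 1 - s / 7 \<longleftrightarrow> \<not> y x < 1 - s / 7" "z x > 1 - t / 7 \<longleftrightarrow> \<not> z x < 1 - t / 7"
    using y_neq[of x] z_neq[of x] by auto
  note E = e_bounds[OF assms(1)]
  have cmp: "x < s" "x < t" "x < s + t" "\<not> s \<le> x" "\<not> t \<le> x" "\<not> s + t \<le> x"
    "x - t + 7 < s \<longleftrightarrow> x < s + t - 7" "s + t - 7 \<le> x \<longleftrightarrow> \<not> x < s + t - 7"
    using assms st by auto
  have e: "e x = 0 \<or> e x = 1 \<or> e x = 2" using E(1,2) by auto
  show "contribution x \<in> {0, 1}"
    "contribution x = 1 \<Longrightarrow> e x = 0 \<or> (e x = 1 \<and> y x > 1 - s / 7 \<and> z x > 1 - t / 7)"
    "contribution x = 1 \<Longrightarrow> x < s + t - 7 \<Longrightarrow> e x = 0 \<and> y x < 1 - s / 7 \<and> z x < 1 - t / 7"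
    using e E(3-6) unfolding contribution_def m gt
    by (elim disjE; cases "y x < 1 - s / 7"; cases "z x < 1 - t / 7";
        cases "x < s + t - 7"; simp add: cmp split: if_splits; fail)+
qed

lemma contribution_middle:
  assumes "x \<in> {0..6}" "s \<le> x" "x < t"
  shows "contribution x \<in> {0, -1}"
    "contribution x = -1 \<Longrightarrow> e x = 1 \<and> y x > 1 - s / 7 \<and> z x < 1 - t / 7"
proof -
  have m: "(x - t) mod 7 = x - t + 7"
    using mod_pos_pos_trivial[of "x - t + 7" 7] assms st by auto
  have gt: "y x > 1 - s / 7 \<longleftrightarrow> \<not> y x < 1 - s / 7" "z x > 1 - t / 7 \<longleftrightarrow> \<not> z x < 1 - t / 7"
    using y_neq[of x] z_neq[of x] by auto
  note E = e_bounds[OF assms(1)]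
  have cmp: "s \<le> x" "\<not> x < s" "x < t" "\<not> x - t + 7 < s" "\<not> t \<le> x" "\<not> s + t \<le> x"
    "s + t - 7 \<le> x" "\<not> x < s + t - 7"
    using assms st by auto
  have e: "e x = 0 \<or> e x = 1 \<or> e x = 2" using E(1,2) by auto
  show "contribution x \<in> {0, -1}"
    "contribution x = -1 \<Longrightarrow> e x = 1 \<and> y x > 1 - s / 7 \<and> z x < 1 - t / 7"
    using e E(3-6) unfolding contribution_def m gt
    by (elim disjE; cases "y x < 1 - s / 7"; cases "z x < 1 - t / 7";
        cases "x < s + t - 7"; simp add: cmp split: if_splits; fail)+
qed

lemma contribution_upper:
  assumes "x \<in> {0..6}" "t \<le> x" "x < s + t"
  shows "contribution x \<in> {0, -1}"
    "contribution x = -1 \<Longrightarrow> e x = 0 \<or> (e x = 1 \<and> (y x > 1 - s / 7 \<or> z x > 1 - t / 7))"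
proof -
  have m: "(x - t) mod 7 = x - t"
    using mod_pos_pos_trivial[of "x - t" 7] assms st by auto
  have gt: "y x > 1 - s / 7 \<longleftrightarrow> \<not> y x < 1 - s / 7" "z x > 1 - t / 7 \<longleftrightarrow> \<not> z x < 1 - t / 7"
    using y_neq[of x] z_neq[of x] by auto
  note E = e_bounds[OF assms(1)]
  have cmp: "s \<le> x" "\<not> x < s" "\<not> x < t" "x - t < s" "t \<le> x" "\<not> s + t \<le> x"
    "s + t - 7 \<le> x" "\<not> x < s + t - 7"
    using assms st by auto
  have e: "e x = 0 \<or> e x = 1 \<or> e x = 2" using E(1,2) by auto
  show "contribution x \<in> {0, -1}"
    "contribution x = -1 \<Longrightarrow> e x = 0 \<or> (e x = 1 \<and> (y x > 1 - s / 7 \<or> z x > 1 - t / 7))"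
    using e E(3-6) unfolding contribution_def m gt
    by (elim disjE; cases "y x < 1 - s / 7"; cases "z x < 1 - t / 7";
        cases "x < s + t - 7"; simp add: cmp split: if_splits; fail)+
qed

lemma contribution_top:
  assumes "x \<in> {0..6}" "s + t \<le> x"
  shows "contribution x \<in> {0, 1}"
    "contribution x = 1 \<Longrightarrow> e x = 2 \<and> y x > 1 - s / 7 \<and> z x > 1 - t / 7"
proof -
  have m: "(x - t) mod 7 = x - t"
    using mod_pos_pos_trivial[of "x - t" 7] assms st by auto
  have gt: "y x > 1 - s / 7 \<longleftrightarrow> \<not> y x < 1 - s / 7" "z x > 1 - t / 7 \<longleftrightarrow> \<not> z x < 1 - t / 7"
    using y_neq[of x] z_neq[of x] by auto
  note E = e_bounds[OF assms(1)]
  have cmp: "s \<le> x" "\<not> x < s" "\<not> x < t" "\<not> x - t < s" "t \<le> x" "s + t \<le> x"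
    "s + t - 7 \<le> x" "\<not> x < s + t - 7"
    using assms st by auto
  have e: "e x = 0 \<or> e x = 1 \<or> e x = 2" using E(1,2) by auto
  show "contribution x \<in> {0, 1}"
    "contribution x = 1 \<Longrightarrow> e x = 2 \<and> y x > 1 - s / 7 \<and> z x > 1 - t / 7"
    using e E(3-6) unfolding contribution_def m gt
    by (elim disjE; cases "y x < 1 - s / 7"; cases "z x < 1 - t / 7";
        cases "x < s + t - 7"; simp add: cmp split: if_splits; fail)+
qed

text \<open>
  In each of three ranges, nonzero contributions confine \<open>y x + z x\<close> to an interval and fix the
  carry. Since \<open>x / 7\<close> is determined by these up to a constant, digits with a nonzero contribution
  cannot be far apart.
\<close>

lemma top_gap:
  assumes "s + t \<le> x" "x \<le> x'" "x' \<le> 6" "contribution x = 1" "contribution x' = 1"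
  shows "x' - x < s + t"
proof -
  have "x \<in> {0..6}" "x' \<in> {0..6}" "s + t \<le> x'" using assms st by auto
  thus ?thesis
    using contribution_top(2)[of x] contribution_top(2)[of x'] sum[of x] sum[of x'] y(2)[of x] z(2)[of x] assms
      by simp
qed

lemma low_gap:
  assumes "0 \<le> x" "x \<le> x'" "x' < s + t - 7" "contribution x = 1" "contribution x' = 1"
  shows "x' - x < 14 - s - t"
proof -
  have "x \<in> {0..6}" "x' \<in> {0..6}" "x < s" "x' < s" using assms st by auto
  thus ?thesis
    using contribution_low(3)[of x] contribution_low(3)[of x'] sum[of x] sum[of x'] y(1)[of x'] z(1)[of x']
      assms by simp
qed

lemma middle_gap:
  assumes "s \<le> x" "x \<le> x'" "x' < t" "contribution x = -1" "contribution x' = -1"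
  shows "x' - x < 7 - t + s"
proof -
  have "x \<in> {0..6}" "x' \<in> {0..6}" "s \<le> x'" "x < t" using assms st by auto
  thus ?thesis
    using contribution_middle(2)[of x] contribution_middle(2)[of x'] sum[of x] sum[of x'] y(2)[of x]
      z(1)[of x'] assms
    by simp
qed

text \<open>
  For most pairs \<open>(s, t)\<close> counting digits and the gap lemmas suffice. For the pairs \<open>(2, 2)\<close>,
  \<open>(5, 5)\<close> and \<open>(2, 5)\<close> five digits could contribute with the same sign as far as single digits
  are concerned. There the order of the digits within the window matters.
\<close>

definition pos :: "int \<Rightarrow> int" where "pos x = (n - x * \<kappa>) mod 7"

lemma y_pos: "pos x - pos x' = k \<Longrightarrow> y x - y x' + of_int k * \<delta> \<in> \<int>"
  using y_step[of x x'] unfolding pos_def by blast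

lemma z_pos: "pos x - pos x' = k \<Longrightarrow> z x - z x' + of_int k * \<epsilon> \<in> \<int>"
  using z_step[of x x'] unfolding pos_def by blast

text \<open>
  The digit sum is constant modulo 1 over the window, so the two step lengths determine each
  other.
\<close>

lemma step_sum:
  assumes "pos x - pos x' = 1" "x \<in> {0..6}" "x' \<in> {0..6}"
  shows "\<delta> + \<epsilon> - of_int (x - x') / 7 \<in> \<int>"
proof -
  have eq: "\<delta> + \<epsilon> - of_int (x - x') / 7 =
    (y x - y x' + of_int 1 * \<delta>) + (z x - z x' + of_int 1 * \<epsilon>) - of_int (e x - e x')"
    using sum[OF assms(2)] sum[OF assms(3)] by (simp add: field_simps)
  show ?thesis
    unfolding eq by (intro Ints_add Ints_diff y_pos z_pos assms Ints_of_int)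
qed

text \<open>
  Only the residues of \<open>\<kappa>\<close> and \<open>n\<close> modulo 7 matter for positions, and \<open>\<kappa>\<close> is the inverse of
  \<open>s * t\<close>.
\<close>

lemma pos_eq:
  assumes "(k * s * t) mod 7 = 1" "n mod 7 = \<nu>"
  shows "pos x = (\<nu> - x * k) mod 7"
proof -
  have "(\<kappa> * (k * s * t)) mod 7 = (k * (\<kappa> * s * t)) mod 7" by (simp add: mult_ac)
  hence "\<kappa> mod 7 = k mod 7"
    by (metis assms(1) kappa mod_mult_right_eq mult.right_neutral)
  thus ?thesis unfolding pos_def using assms(2)
    by (metis mod_diff_cong mod_mod_trivial mod_mult_right_eq)
qed

text \<open>
  If all five digits contributed, the points of the digits 4, 5, 6 would lie in the arc above 5/7
  for both progressions, while the two points of the digit 1 would have a sum below 3/7.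
  Cyclically the digits occur in the order 4, 0, 3, 6, 2, 5, 1. If 5, 1, 4 are consecutive in the
  window, the point of 1 is a midpoint of two points of the short arc, which makes it larger than
  3/14 in both progressions. The other two windows start with 4 or with 1; there the digits 4, 6,
  5 make both progressions narrow, so that one of them hardly moves at each step, and this
  contradicts the conditions on the digit 1 or 0.
\<close>

lemma not_all_positive_2_2:
  assumes "s = 2" "t = 2" "contribution 0 = 1" "contribution 1 = 1" "contribution 4 = 1" "contribution 5 = 1"
    "contribution 6 = 1"
  shows False
proof -
  have C4: "y 4 > 5/7" "z 4 > 5/7" "y 4 + z 4 = 10/7 + \<theta>" using contribution_top(2)[of 4] sum[of 4] assms by auto
  have C5: "y 5 > 5/7" "z 5 > 5/7" using contribution_top(2)[of 5] assms by auto
  have C6: "y 6 > 5/7" "z 6 > 5/7" using contribution_top(2)[of 6] assms by auto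
  have \<theta>4: "\<theta> < 4/7" using C4 y(2)[of 4] z(2)[of 4] by linarith
  have D1: "y 1 + z 1 < 3/7" using contribution_low(2)[of 1] sum[of 1] assms \<theta>4 by auto
  have D0: "(y 0 + z 0 < 4/7) \<or> (y 0 > 5/7 \<and> z 0 > 5/7)"
    using contribution_low(2)[of 0] sum[of 0] assms \<theta>4 by auto
  note lim = y[of 0] y[of 1] y[of 4] y[of 5] y[of 6] z[of 0] z[of 1] z[of 4] z[of 5] z[of 6]
  define \<nu> where "\<nu> = n mod 7"
  have pos: "pos x = (\<nu> - x * 2) mod 7" for x
    using pos_eq[of 2] assms by (simp add: \<nu>_def)
  have "\<nu> \<in> {0..<7}" by (simp add: \<nu>_def)
  then consider "\<nu> = 1" | "\<nu> = 2" | "\<nu> = 0 \<or> \<nu> = 3 \<or> \<nu> = 4 \<or> \<nu> = 5 \<or> \<nu> = 6" by fastforce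
  thus False
  proof cases
    case 3
    \<comment> \<open>The window has 5, 1, 4 in a row.\<close>
    have p: "pos 1 - pos 5 = 1" "pos 4 - pos 1 = 1" using 3 by (auto simp: pos)
    have "y 5 + y 4 - 2 * y 1 \<in> \<int>" "z 5 + z 4 - 2 * z 1 \<in> \<int>"
      using y_pos[OF p(1)] y_pos[OF p(2)] z_pos[OF p(1)] z_pos[OF p(2)]
      by (auto intro: Ints_midpoint)
    from this[THEN Ints_eq_1] show False using C4 C5 D1 lim by argo
  next
    case 1
    \<comment> \<open>The window is 4, 0, 3, 6, 2, 5, 1: the slow progression cannot get from 5 to 1.\<close>
    have p: "pos 6 - pos 4 = 3" "pos 5 - pos 6 = 2" "pos 1 - pos 5 = 1"
      using 1 by (simp_all add: pos)
    have *: "\<delta> + \<epsilon> - 3/7 \<in> \<int>"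
      using Ints_add[OF step_sum[OF p(3)] Ints_minus[OF Ints_1]] by simp
    have "3 * \<delta> - (y 4 - y 6) \<in> \<int>" "2 * \<delta> - (y 6 - y 5) \<in> \<int>"
      "3 * \<epsilon> - (z 4 - z 6) \<in> \<int>" "2 * \<epsilon> - (z 6 - z 5) \<in> \<int>"
      using y_pos[OF p(1)] y_pos[OF p(2)] z_pos[OF p(1)] z_pos[OF p(2)] by (simp_all add: algebra_simps)
    note steps = narrow_steps[OF this(1) _ this(2) _ this(3) _ this(4) _ *]
    have no: False if "f 5 > 5/7" "f 5 < 1" "0 \<le> f 1" "f 1 < 3/7" "0 < d" "d < 1/14"
      "f 1 - f 5 + d \<in> \<int>" for f :: "int \<Rightarrow> real" and d
      using Ints_eq_0[OF that(7)] that by argo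
    show False
    proof (rule steps)
      show False if d: "0 < d" "d < 1/14" "\<delta> - d \<in> \<int>" for d
        using no[of y d] Ints_shift_step[OF y_pos[OF p(3)] d(3)] d lim C5 D1 by simp
      show False if d: "0 < d" "d < 1/14" "\<epsilon> - d \<in> \<int>" for d
        using no[of z d] Ints_shift_step[OF z_pos[OF p(3)] d(3)] d lim C5 D1 by simp
    qed (use lim C4 C5 C6 in linarith)+
  next
    case 2
    \<comment> \<open>The window is 1, 4, 0, 3, 6, 2, 5: the fast progression leaves the arc at 0 while the
      slow one stays high.\<close>
    have p: "pos 6 - pos 4 = 3" "pos 5 - pos 6 = 2" "pos 4 - pos 1 = 1" "pos 0 - pos 4 = 1"
      using 2 by (simp_all add: pos)
    have *: "\<delta> + \<epsilon> - 3/7 \<in> \<int>" using step_sum[OF p(3)] by simp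
    have "3 * \<delta> - (y 4 - y 6) \<in> \<int>" "2 * \<delta> - (y 6 - y 5) \<in> \<int>"
      "3 * \<epsilon> - (z 4 - z 6) \<in> \<int>" "2 * \<epsilon> - (z 6 - z 5) \<in> \<int>"
      using y_pos[OF p(1)] y_pos[OF p(2)] z_pos[OF p(1)] z_pos[OF p(2)] by (simp_all add: algebra_simps)
    note steps = narrow_steps[OF this(1) _ this(2) _ this(3) _ this(4) _ *]
    have no: False if "f 4 > 5/7" "f 4 < 1" "g 4 > 5/7" "g 4 < 1" "0 \<le> f 0" "0 \<le> g 0" "g 0 < 1"
      "f 0 < 1" "(f 0 + g 0 < 4/7) \<or> (f 0 > 5/7 \<and> g 0 > 5/7)"
      "0 < d" "d < 1/14" "f 0 - f 4 + d \<in> \<int>" "g 0 - g 4 + (3/7 - d) \<in> \<int>"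
      for f g :: "int \<Rightarrow> real" and d
      using Ints_eq_0[OF that(12)] Ints_eq_0[OF that(13)] that(1-11) by argo
    show False
    proof (rule steps)
      show False if d: "0 < d" "d < 1/14" "\<delta> - d \<in> \<int>" "\<epsilon> - (3/7 - d) \<in> \<int>" for d
        using no[of y z d] Ints_shift_step[OF y_pos[OF p(4)] d(3)] Ints_shift_step[OF z_pos[OF p(4)] d(4)]
           d lim C4 D0 by simp
      show False if d: "0 < d" "d < 1/14" "\<epsilon> - d \<in> \<int>" "\<delta> - (3/7 - d) \<in> \<int>" for d
        using no[of z y d] Ints_shift_step[OF z_pos[OF p(4)] d(3)] Ints_shift_step[OF y_pos[OF p(4)] d(4)]
           d lim C4 D0 by (simp add: add.commute conj_commute)
    qed (use lim C4 C5 C6 in linarith)+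
  qed
qed

text \<open>
  Here the digits 0, 1, 2 have their points in the arc below 2/7, and the points of the digit 4
  are both above 2/7 with sum below 1. The cyclic order is 0, 3, 6, 2, 5, 1, 4, so the digit 4
  lies between 1 and 0 unless the window starts with 0 or with 4. A midpoint of two points of the
  short arc that is not in the arc itself is at least 1/2, which is too much for the sum. In the
  two other windows the digits 0, 2, 1 make the progressions narrow.
\<close>

lemma not_all_positive_5_5:
  assumes "s = 5" "t = 5" "contribution 0 = 1" "contribution 1 = 1" "contribution 2 = 1" "contribution 3 = 1"
    "contribution 4 = 1"
  shows False
proof -
  have C0: "y 0 < 2/7" "z 0 < 2/7" "y 0 + z 0 = \<theta>" using contribution_low(3)[of 0] sum[of 0] assms by auto
  have C1: "y 1 < 2/7" "z 1 < 2/7" using contribution_low(3)[of 1] assms by auto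
  have C2: "y 2 < 2/7" "z 2 < 2/7" using contribution_low(3)[of 2] assms by auto
  have \<theta>4: "\<theta> < 4/7" using C0 by linarith
  have D4: "y 4 > 2/7" "z 4 > 2/7" "y 4 + z 4 < 1"
    using contribution_low(2)[of 4] sum[of 4] y(1)[of 4] z(1)[of 4] assms \<theta>4 by auto
  have D3: "(y 3 + z 3 < 1/7) \<or> (y 3 > 2/7 \<and> z 3 > 2/7)"
    using contribution_low(2)[of 3] sum[of 3] assms \<theta>4 by auto
  note lim = y[of 0] y[of 1] y[of 2] y[of 3] y[of 4] z[of 0] z[of 1] z[of 2] z[of 3] z[of 4]
  define \<nu> where "\<nu> = n mod 7"
  have pos: "pos x = (\<nu> - x * 2) mod 7" for x
    using pos_eq[of 2] assms by (simp add: \<nu>_def)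
  have "\<nu> \<in> {0..<7}" by (simp add: \<nu>_def)
  then consider "\<nu> = 0" | "\<nu> = 1" | "\<nu> = 2 \<or> \<nu> = 3 \<or> \<nu> = 4 \<or> \<nu> = 5 \<or> \<nu> = 6" by fastforce
  thus False
  proof cases
    case 3
    \<comment> \<open>The window has 1, 4, 0 in a row.\<close>
    have p: "pos 4 - pos 1 = 1" "pos 0 - pos 4 = 1" using 3 by (auto simp: pos)
    have "1 + (y 1 + y 0 - 2 * y 4) \<in> \<int>" "1 + (z 1 + z 0 - 2 * z 4) \<in> \<int>"
      using y_pos[OF p(1)] y_pos[OF p(2)] z_pos[OF p(1)] z_pos[OF p(2)]
      by (auto intro!: Ints_add[OF Ints_1] Ints_midpoint)
    from this[THEN Ints_eq_0] show False using C0 C1 D4 lim by argo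
  next
    case 1
    \<comment> \<open>The window is 0, 3, 6, 2, 5, 1, 4: the slow progression can leave the arc after 1 only
      downwards across 0, to a point close to 1.\<close>
    have p: "pos 2 - pos 0 = 3" "pos 1 - pos 2 = 2" "pos 4 - pos 1 = 1"
      using 1 by (simp_all add: pos)
    have *: "\<delta> + \<epsilon> - 3/7 \<in> \<int>" using step_sum[OF p(3)] by simp
    have "3 * \<delta> - (y 0 - y 2) \<in> \<int>" "2 * \<delta> - (y 2 - y 1) \<in> \<int>"
      "3 * \<epsilon> - (z 0 - z 2) \<in> \<int>" "2 * \<epsilon> - (z 2 - z 1) \<in> \<int>"
      using y_pos[OF p(1)] y_pos[OF p(2)] z_pos[OF p(1)] z_pos[OF p(2)] by (simp_all add: algebra_simps)
    note steps = narrow_steps[OF this(1) _ this(2) _ this(3) _ this(4) _ *]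
    have no: False if "0 \<le> f 1" "f 1 < 2/7" "2/7 < f 4" "2/7 < g 4" "f 4 + g 4 < 1"
      "0 < d" "d < 1/14" "f 4 - f 1 + d \<in> \<int>" for f g :: "int \<Rightarrow> real" and d
      using Ints_eq_1[OF that(8)] that(1-7) by argo
    show False
    proof (rule steps)
      show False if d: "0 < d" "d < 1/14" "\<delta> - d \<in> \<int>" for d
        using no[of y z d] Ints_shift_step[OF y_pos[OF p(3)] d(3)] d lim C1 D4 by simp
      show False if d: "0 < d" "d < 1/14" "\<epsilon> - d \<in> \<int>" for d
        using no[of z y d] Ints_shift_step[OF z_pos[OF p(3)] d(3)] d lim C1 D4
        by (simp add: add.commute)
    qed (use lim C0 C1 C2 in linarith)+
  next
    case 2
    \<comment> \<open>The window is 4, 0, 3, 6, 2, 5, 1: the slow progression enters the arc at 0 and is still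
      inside it at 3.\<close>
    have p: "pos 2 - pos 0 = 3" "pos 1 - pos 2 = 2" "pos 0 - pos 4 = 1" "pos 3 - pos 0 = 1"
      using 2 by (simp_all add: pos)
    have *: "\<delta> + \<epsilon> - 3/7 \<in> \<int>" using step_sum[OF p(4)] by simp
    have "3 * \<delta> - (y 0 - y 2) \<in> \<int>" "2 * \<delta> - (y 2 - y 1) \<in> \<int>"
      "3 * \<epsilon> - (z 0 - z 2) \<in> \<int>" "2 * \<epsilon> - (z 2 - z 1) \<in> \<int>"
      using y_pos[OF p(1)] y_pos[OF p(2)] z_pos[OF p(1)] z_pos[OF p(2)] by (simp_all add: algebra_simps)
    note steps = narrow_steps[OF this(1) _ this(2) _ this(3) _ this(4) _ *]
    have no: False if "0 \<le> f 0" "f 0 < 2/7" "2/7 < f 4" "f 4 < 1" "0 \<le> f 3" "f 3 < 1" "0 \<le> g 3"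
      "(f 3 + g 3 < 1/7) \<or> (f 3 > 2/7 \<and> g 3 > 2/7)"
      "0 < d" "d < 1/14" "f 0 - f 4 + d \<in> \<int>" "f 3 - f 0 + d \<in> \<int>"
      for f g :: "int \<Rightarrow> real" and d
      using Ints_eq_0[OF that(11)] Ints_eq_0[OF that(12)] that(1-10) by argo
    show False
    proof (rule steps)
      show False if d: "0 < d" "d < 1/14" "\<delta> - d \<in> \<int>" for d
        using no[of y z d] Ints_shift_step[OF y_pos[OF p(3)] d(3)] Ints_shift_step[OF y_pos[OF p(4)] d(3)]
           d lim C0 D4 D3 by simp
      show False if d: "0 < d" "d < 1/14" "\<epsilon> - d \<in> \<int>" for d
        using no[of z y d] Ints_shift_step[OF z_pos[OF p(3)] d(3)] Ints_shift_step[OF z_pos[OF p(4)] d(3)]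
           d lim C0 D4 D3 by (simp add: add.commute conj_commute)
    qed (use lim C0 C1 C2 in linarith)+
  qed
qed

text \<open>
  The mixed case: the digits 2, 3, 4 have \<open>y x\<close> above 5/7 and \<open>z x\<close> below 2/7, and the digit 6 has
  \<open>y 6 + z 6\<close> below 5/7 and \<open>z 6\<close> above 2/7. The cyclic order is 2, 6, 3, 0, 4, 1, 5, and the
  digit 6 lies between 2 and 3 unless the window starts with 3 or with 6. The two progressions
  play different roles and turn backwards, which is why the negated steps are used.
\<close>

lemma not_all_negative_2_5:
  assumes "s = 2" "t = 5" "contribution 2 = -1" "contribution 3 = -1" "contribution 4 = -1"
    "contribution 5 = -1" "contribution 6 = -1"
  shows False
proof -
  have C2: "y 2 > 5/7" "z 2 < 2/7" "y 2 + z 2 = 5/7 + \<theta>" using contribution_middle(2)[of 2] sum[of 2] assms by auto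
  have C3: "y 3 > 5/7" "z 3 < 2/7" using contribution_middle(2)[of 3] assms by auto
  have C4: "y 4 > 5/7" "z 4 < 2/7" using contribution_middle(2)[of 4] assms by auto
  note lim = y[of 2] y[of 3] y[of 4] y[of 5] y[of 6] z[of 2] z[of 3] z[of 4] z[of 5] z[of 6]
  have \<theta>4: "\<theta> < 4/7" using C2 lim by linarith
  have D5: "y 5 + z 5 < 6/7" "y 5 > 5/7 \<or> z 5 > 2/7"
    using contribution_upper(2)[of 5] sum[of 5] y(1)[of 5] z(1)[of 5] assms \<theta>4 by auto
  have "y 6 + z 6 < 5/7" "y 6 > 5/7 \<or> z 6 > 2/7"
    using contribution_upper(2)[of 6] sum[of 6] y(1)[of 6] z(1)[of 6] assms \<theta>4 by auto
  hence D6: "y 6 + z 6 < 5/7" "z 6 > 2/7" using lim by auto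
  define \<nu> where "\<nu> = n mod 7"
  have pos: "pos x = (\<nu> - x * 5) mod 7" for x
    using pos_eq[of 5] assms by (simp add: \<nu>_def)
  have "\<nu> \<in> {0..<7}" by (simp add: \<nu>_def)
  then consider "\<nu> = 1" | "\<nu> = 2" | "\<nu> = 0 \<or> \<nu> = 3 \<or> \<nu> = 4 \<or> \<nu> = 5 \<or> \<nu> = 6" by fastforce
  thus False
  proof cases
    case 3
    \<comment> \<open>The window has 2, 6, 3 in a row.\<close>
    have p: "pos 6 - pos 2 = 1" "pos 3 - pos 6 = 1" using 3 by (auto simp: pos)
    have "y 2 + y 3 - 2 * y 6 \<in> \<int>" "1 + (z 2 + z 3 - 2 * z 6) \<in> \<int>"
      using y_pos[OF p(1)] y_pos[OF p(2)] z_pos[OF p(1)] z_pos[OF p(2)]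
      by (auto intro!: Ints_add[OF Ints_1] Ints_midpoint)
    from Ints_eq_1[OF this(1)] Ints_eq_0[OF this(2)] show False using C2 C3 D6 lim by argo
  next
    case 1
    \<comment> \<open>The window is 3, 0, 4, 1, 5, 2, 6: the slow progression crosses the end of its arc
      between 2 and 6, so the digit 5 is still inside, and y 5 + z 5 is too large.\<close>
    have p: "pos 2 - pos 4 = 3" "pos 4 - pos 3 = 2" "pos 6 - pos 2 = 1" "pos 2 - pos 5 = 1"
      using 1 by (simp_all add: pos)
    have *: "- \<delta> + - \<epsilon> - 3/7 \<in> \<int>"
      using Ints_minus[OF Ints_add[OF step_sum[OF p(3)] Ints_1]] by simp
    have "3 * (- \<delta>) - (y 2 - y 4) \<in> \<int>" "2 * (- \<delta>) - (y 4 - y 3) \<in> \<int>"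
      "3 * (- \<epsilon>) - (z 2 - z 4) \<in> \<int>" "2 * (- \<epsilon>) - (z 4 - z 3) \<in> \<int>"
      using Ints_minus[OF y_pos[OF p(1)]] Ints_minus[OF y_pos[OF p(2)]]
        Ints_minus[OF z_pos[OF p(1)]] Ints_minus[OF z_pos[OF p(2)]] by (simp_all add: algebra_simps)
    note steps = narrow_steps[OF this(1) _ this(2) _ this(3) _ this(4) _ *]
    show False
    proof (rule steps)
      show False if d: "0 < d" "d < 1/14" "- \<delta> - d \<in> \<int>" for d
      proof -
        have d': "\<delta> - (- d) \<in> \<int>" using Ints_minus[OF d(3)] by (simp add: add.commute)
        have "y 6 - y 2 - d + 1 \<in> \<int>" "y 2 - y 5 - d \<in> \<int>"
          using Ints_shift_step[OF y_pos[OF p(3)] d'] Ints_shift_step[OF y_pos[OF p(4)] d'] by simp_all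
        thus False using Ints_eq_0[of "y 6 - y 2 - d + 1"] Ints_eq_0[of "y 2 - y 5 - d"]
            d lim C2 D5 D6 by argo
      qed
      show False if d: "0 < d" "d < 1/14" "- \<epsilon> - d \<in> \<int>" for d
      proof -
        have d': "\<epsilon> - (- d) \<in> \<int>" using Ints_minus[OF d(3)] by (simp add: add.commute)
        have "z 6 - z 2 - d \<in> \<int>" "z 2 - z 5 - d \<in> \<int>"
          using Ints_shift_step[OF z_pos[OF p(3)] d'] Ints_shift_step[OF z_pos[OF p(4)] d'] by simp_all
        thus False using Ints_eq_0[of "z 6 - z 2 - d"] Ints_eq_0[of "z 2 - z 5 - d"]
            d lim C2 D5 D6 by argo
      qed
    qed (use lim C2 C3 C4 in linarith)+
  next
    case 2
    \<comment> \<open>The window is 6, 3, 0, 4, 1, 5, 2: the slow progression cannot get from 6 to 3.\<close>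
    have p: "pos 2 - pos 4 = 3" "pos 4 - pos 3 = 2" "pos 3 - pos 6 = 1"
      using 2 by (simp_all add: pos)
    have *: "- \<delta> + - \<epsilon> - 3/7 \<in> \<int>"
      using Ints_minus[OF step_sum[OF p(3)]] by simp
    have "3 * (- \<delta>) - (y 2 - y 4) \<in> \<int>" "2 * (- \<delta>) - (y 4 - y 3) \<in> \<int>"
      "3 * (- \<epsilon>) - (z 2 - z 4) \<in> \<int>" "2 * (- \<epsilon>) - (z 4 - z 3) \<in> \<int>"
      using Ints_minus[OF y_pos[OF p(1)]] Ints_minus[OF y_pos[OF p(2)]]
        Ints_minus[OF z_pos[OF p(1)]] Ints_minus[OF z_pos[OF p(2)]] by (simp_all add: algebra_simps)
    note steps = narrow_steps[OF this(1) _ this(2) _ this(3) _ this(4) _ *]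
    show False
    proof (rule steps)
      show False if d: "0 < d" "d < 1/14" "- \<delta> - d \<in> \<int>" for d
      proof -
        have d': "\<delta> - (- d) \<in> \<int>" using Ints_minus[OF d(3)] by (simp add: add.commute)
        have "y 3 - y 6 - d \<in> \<int>" using Ints_shift_step[OF y_pos[OF p(3)] d'] by simp
        thus False using Ints_eq_0[of "y 3 - y 6 - d"] d lim C3 D6 by argo
      qed
      show False if d: "0 < d" "d < 1/14" "- \<epsilon> - d \<in> \<int>" for d
      proof -
        have d': "\<epsilon> - (- d) \<in> \<int>" using Ints_minus[OF d(3)] by (simp add: add.commute)
        have "z 3 - z 6 - d \<in> \<int>" using Ints_shift_step[OF z_pos[OF p(3)] d'] by simp
        thus False using Ints_eq_0[of "z 3 - z 6 - d"] d lim C3 D6 by argo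
      qed
    qed (use lim C2 C3 C4 in linarith)+
  qed
qed

lemma contribution_le_1: "x \<in> {0..6} \<Longrightarrow> contribution x \<le> 1" and contribution_ge: "x \<in> {0..6} \<Longrightarrow> contribution x \<ge> -1"
  using contribution_low(1)[of x] contribution_middle(1)[of x] contribution_upper(1)[of x]
    contribution_top(1)[of x] by force+

lemma contribution_nonpos: "x \<in> {0..6} \<Longrightarrow> s \<le> x \<Longrightarrow> x < s + t \<Longrightarrow> contribution x \<le> 0"
  using contribution_middle(1)[of x] contribution_upper(1)[of x] by force

lemma contribution_nonneg: "x \<in> {0..6} \<Longrightarrow> x < s \<or> s + t \<le> x \<Longrightarrow> contribution x \<ge> 0"
  using contribution_low(1)[of x] contribution_top(1)[of x] by force

lemma sum_contribution: "(\<Sum>x=0..6. contribution x) = contribution 0 + contribution 1 + contribution 2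
  + contribution 3 + contribution 4 + contribution 5 + contribution 6"
proof -
  have "{0..6::int} = {0,1,2,3,4,5,6}" by auto
  thus ?thesis by simp
qed

text \<open>
  The digits from \<open>s\<close> up to \<open>s + t - 1\<close> never contribute positively. This leaves more than four
  digits only in six cases.
\<close>

lemma sum_contribution_le: "(\<Sum>x=0..6. contribution x) \<le> 4"
proof -
  have le: "contribution 0 \<le> 1" "contribution 1 \<le> 1" "contribution 2 \<le> 1" "contribution 3 \<le> 1"
    "contribution 4 \<le> 1" "contribution 5 \<le> 1" "contribution 6 \<le> 1"
    by (simp_all add: contribution_le_1)
  consider "s \<le> 4" "3 \<le> t" | "s = 1" "t = 1" | "s = 1" "t = 2" | "s = 2" "t = 2"
    | "s = 5" "t = 5" | "s = 5" "t = 6" | "s = 6" "t = 6"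
    using st by linarith
  thus ?thesis
  proof cases
    case 1
    have "contribution s \<le> 0" "contribution (s + 1) \<le> 0" "contribution (s + 2) \<le> 0" using 1 st by (auto intro!:
      contribution_nonpos)
    moreover have "s = 1 \<or> s = 2 \<or> s = 3 \<or> s = 4" using 1 st by auto
    ultimately show ?thesis unfolding sum_contribution using le by (elim disjE) simp_all
  next
    case 2
    have "contribution 1 \<le> 0" by (rule contribution_nonpos; use 2 in simp)+
    moreover have "contribution 2 \<noteq> 1 \<or> contribution 4 \<noteq> 1" using top_gap[of 2 4] 2 by auto
    moreover have "contribution 3 \<noteq> 1 \<or> contribution 5 \<noteq> 1" using top_gap[of 3 5] 2 by auto
    ultimately show ?thesis unfolding sum_contribution using le by linarith
  next
    case 3
    have "contribution 1 \<le> 0" "contribution 2 \<le> 0" by (rule contribution_nonpos; use 3 in simp)+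
    moreover have "contribution 3 \<noteq> 1 \<or> contribution 6 \<noteq> 1" using top_gap[of 3 6] 3 by auto
    ultimately show ?thesis unfolding sum_contribution using le by linarith
  next
    case 4
    have "contribution 2 \<le> 0" "contribution 3 \<le> 0" by (rule contribution_nonpos; use 4 in simp)+
    moreover have "contribution 0 \<noteq> 1 \<or> contribution 1 \<noteq> 1 \<or> contribution 4 \<noteq> 1 \<or> contribution 5 \<noteq> 1 \<or>
      contribution 6 \<noteq> 1"
      using not_all_positive_2_2[OF 4] by blast
    ultimately show ?thesis unfolding sum_contribution using le by linarith
  next
    case 5
    have "contribution 5 \<le> 0" "contribution 6 \<le> 0" by (rule contribution_nonpos; use 5 in simp)+
    moreover have "contribution 0 \<noteq> 1 \<or> contribution 1 \<noteq> 1 \<or> contribution 2 \<noteq> 1 \<or> contribution 3 \<noteq> 1 \<or>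
      contribution 4 \<noteq> 1"
      using not_all_positive_5_5[OF 5] by blast
    ultimately show ?thesis unfolding sum_contribution using le by linarith
  next
    case 6
    have "contribution 5 \<le> 0" "contribution 6 \<le> 0" by (rule contribution_nonpos; use 6 in simp)+
    moreover have "contribution 0 \<noteq> 1 \<or> contribution 3 \<noteq> 1" using low_gap[of 0 3] 6 by auto
    ultimately show ?thesis unfolding sum_contribution using le by linarith
  next
    case 7
    have "contribution 6 \<le> 0" by (rule contribution_nonpos; use 7 in simp)+
    moreover have "contribution 0 \<noteq> 1 \<or> contribution 2 \<noteq> 1" using low_gap[of 0 2] 7 by auto
    moreover have "contribution 1 \<noteq> 1 \<or> contribution 3 \<noteq> 1" using low_gap[of 1 3] 7 by auto
    ultimately show ?thesis unfolding sum_contribution using le by linarith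
  qed
qed

text \<open>
  Dually, only the digits from \<open>s\<close> up to \<open>s + t - 1\<close> can contribute negatively, and four cases
  need an argument.
\<close>

lemma sum_contribution_ge: "(\<Sum>x=0..6. contribution x) \<ge> -4"
proof -
  have ge: "contribution 0 \<ge> -1" "contribution 1 \<ge> -1" "contribution 2 \<ge> -1" "contribution 3 \<ge> -1"
    "contribution 4 \<ge> -1" "contribution 5 \<ge> -1" "contribution 6 \<ge> -1"
    by (simp_all add: contribution_ge)
  have V0: "contribution 0 \<ge> 0" using st by (intro contribution_nonneg) auto
  consider "3 \<le> s" | "s = 2" "t \<le> 4" | "s = 1" "t \<le> 4" | "s = 1" "t = 5" | "s = 1" "t = 6"
    | "s = 2" "t = 5" | "s = 2" "t = 6"
    using st by linarith
  thus ?thesis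
  proof cases
    case 1
    have "contribution 1 \<ge> 0" "contribution 2 \<ge> 0" by (rule contribution_nonneg; use 1 in simp)+
    thus ?thesis unfolding sum_contribution using V0 ge by linarith
  next
    case 2
    have "contribution 1 \<ge> 0" "contribution 6 \<ge> 0" by (rule contribution_nonneg; use 2 in simp)+
    thus ?thesis unfolding sum_contribution using V0 ge by linarith
  next
    case 3
    have "contribution 5 \<ge> 0" "contribution 6 \<ge> 0" by (rule contribution_nonneg; use 3 in simp)+
    thus ?thesis unfolding sum_contribution using V0 ge by linarith
  next
    case 4
    have "contribution 6 \<ge> 0" by (rule contribution_nonneg; use 4 in simp)+
    moreover have "contribution 1 \<noteq> -1 \<or> contribution 4 \<noteq> -1" using middle_gap[of 1 4] 4 by auto
    ultimately show ?thesis unfolding sum_contribution using V0 ge by linarith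
  next
    case 5
    have "contribution 1 \<noteq> -1 \<or> contribution 3 \<noteq> -1" using middle_gap[of 1 3] 5 by auto
    moreover have "contribution 2 \<noteq> -1 \<or> contribution 4 \<noteq> -1" using middle_gap[of 2 4] 5 by auto
    ultimately show ?thesis unfolding sum_contribution using V0 ge by linarith
  next
    case 6
    have "contribution 1 \<ge> 0" by (rule contribution_nonneg; use 6 in simp)+
    moreover have "contribution 2 \<noteq> -1 \<or> contribution 3 \<noteq> -1 \<or> contribution 4 \<noteq> -1 \<or> contribution 5 \<noteq> -1 \<or>
      contribution 6 \<noteq> -1"
      using not_all_negative_2_5[OF 6] by blast
    ultimately show ?thesis unfolding sum_contribution using V0 ge by linarith
  next
    case 7
    have "contribution 1 \<ge> 0" by (rule contribution_nonneg; use 7 in simp)+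
    moreover have "contribution 2 \<noteq> -1 \<or> contribution 5 \<noteq> -1" using middle_gap[of 2 5] 7 by auto
    ultimately show ?thesis unfolding sum_contribution using V0 ge by linarith
  qed
qed

lemma abs_sum_contribution: "\<bar>\<Sum>x=0..6. contribution x\<bar> \<le> 4"
  using sum_contribution_le sum_contribution_ge by linarith

end

section \<open>Residue digits and carries\<close>

lemma mod_diff_wrap:
  fixes a u k :: int
  assumes "0 \<le> a" "a < k" "0 \<le> u" "u \<le> k"
  shows "(a - u) mod k = a - u + k * of_bool (a < u)"
proof (cases "a < u")
  case True
  hence "(a - u + k) mod k = a - u + k" using assms by (intro mod_pos_pos_trivial) auto
  thus ?thesis using True by simp
qed (use assms in \<open>auto intro: mod_pos_pos_trivial\<close>)

text \<open>
  Multiples of \<open>1 / q\<close> stay at distance at least \<open>1 / (7 q)\<close> from \<open>1 - s / 7\<close>, so that the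
  comparison with the threshold is strict and survives the perturbation \<open>\<eta>\<close>.
\<close>

lemma less_threshold_iff:
  fixes q s Y U :: int and \<eta> :: real
  assumes "7 * U = 1 + q * (7 - s)" "coprime q 7" "1 \<le> s" "s \<le> 6" "q > 0"
    and "0 \<le> \<eta>" "\<eta> < 1 / 7"
  shows "Y < U \<longleftrightarrow> (Y + \<eta>) / q < 1 - s / 7" "(Y + \<eta>) / q \<noteq> 1 - s / 7"
proof -
  have "\<not> 7 dvd q * (7 - s)"
  proof
    assume "7 dvd q * (7 - s)"
    hence "7 dvd 7 - s" using assms(2) by (simp add: coprime_commute coprime_dvd_mult_right_iff)
    thus False using assms(3,4) zdvd_imp_le[of 7 "7 - s"] by auto
  qed
  hence neq: "7 * Y \<noteq> q * (7 - s)" by (metis dvd_triv_left)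
  have iff: "(Y + \<eta>) / q < 1 - s / 7 \<longleftrightarrow> 7 * Y + 7 * \<eta> < q * (7 - s)"
    "(Y + \<eta>) / q = 1 - s / 7 \<longleftrightarrow> 7 * Y + 7 * \<eta> = q * (7 - s)"
    using assms(5) by (simp_all add: field_simps)
  consider "7 * Y \<le> q * (7 - s) - 1" | "7 * Y \<ge> q * (7 - s) + 1" using neq by linarith
  hence "(Y < U \<longleftrightarrow> (Y + \<eta>) / q < 1 - s / 7) \<and> (Y + \<eta>) / q \<noteq> 1 - s / 7"
  proof cases
    case 1
    hence "real_of_int (7 * Y) \<le> real_of_int (q * (7 - s) - 1)" by (simp only: of_int_le_iff)
    thus ?thesis using 1 assms(1,6,7) unfolding iff by auto
  next
    case 2
    hence "real_of_int (7 * Y) \<ge> real_of_int (q * (7 - s) + 1)" by (simp only: of_int_le_iff)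
    thus ?thesis using 2 assms(1,6,7) unfolding iff by auto
  qed
  thus "Y < U \<longleftrightarrow> (Y + \<eta>) / q < 1 - s / 7" "(Y + \<eta>) / q \<noteq> 1 - s / 7" by auto
qed

lemma sum_of_fractions:
  fixes a b x y z j :: real
  assumes "a \<noteq> 0" "b \<noteq> 0"
  shows "x / 7 + y / a + (z + j / (7 * a)) / b = (x * (a * b) + y * (7 * b) + z * (7 * a) + j) / (7 * a * b)"
  using assms by (simp add: add_divide_distrib)

text \<open>
  Residues of an arithmetic progression, scaled by the modulus, form an arithmetic progression on
  the circle.
\<close>

lemma Ints_mod_step:
  fixes a b c k :: int
  assumes "k > 0"
  shows "((n - a) * c mod k) / k - ((n - b) * c mod k) / k + (a - b) * (c / k) \<in> \<int>"
proof -
  have d: "real_of_int (z mod k) / k = z / k - (z div k)" for z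
    using assms by (simp add: field_simps minus_mult_div_eq_mod [symmetric])
  have "((n - a) * c mod k) / k - ((n - b) * c mod k) / k + (a - b) * (c / k)
     = of_int ((n - b) * c div k - (n - a) * c div k)"
    unfolding d using assms by (simp add: field_simps)
  thus ?thesis by (metis Ints_of_int)
qed

text \<open>
  The parameters \<open>v\<close> and \<open>w\<close> are the inverses that produce the digits modulo \<open>q\<close> and \<open>r\<close>; the
  inverse of \<open>q r\<close> modulo 7 is \<open>s t\<close>. Nothing distinguishes \<open>q\<close> from \<open>r\<close>, so every statement about
  the shift by \<open>r\<close> gives one about the shift by \<open>q\<close>.
\<close>

locale two_moduli =
  fixes q r s t v w :: int
  assumes q: "q > 7" "coprime q 7" and r: "r > 7" "coprime r 7"
    and s: "1 \<le> s" "s \<le> 6" "[s * q = 1] (mod 7)"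
    and t: "1 \<le> t" "t \<le> 6" "[t * r = 1] (mod 7)"
    and v: "[v * (7 * r) = 1] (mod q)"
    and w: "[w * (7 * q) = 1] (mod r)"
begin

text \<open>
  The residue digits of an integer, the number \<open>F m\<close> that they represent, and the carry \<open>e m\<close>. The
  number \<open>U\<close> is the inverse of 7 modulo \<open>q\<close>, written so that its ratio to \<open>q\<close> is visible.
\<close>

definition X :: "int \<Rightarrow> int" where "X m = (m * (s * t)) mod 7"
definition Y :: "int \<Rightarrow> int" where "Y m = (m * v) mod q"
definition Z :: "int \<Rightarrow> int" where "Z m = (m * w) mod r"
definition F :: "int \<Rightarrow> int" where "F m = X m * (q * r) + Y m * (7 * r) + Z m * (7 * q)"
definition e :: "int \<Rightarrow> int" where "e m = (F m - m) div (7 * q * r)"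
definition U :: int where "U = (1 + q * (7 - s)) div 7"

lemma X_bounds: "0 \<le> X m" "X m < 7" and Y_bounds: "0 \<le> Y m" "Y m < q"
  and Z_bounds: "0 \<le> Z m" "Z m < r"
  using q r by (auto simp: X_def Y_def Z_def)

lemma seven_U: "7 * U = 1 + q * (7 - s)"
proof -
  have "[1 + q * (7 - s) = s * q + q * (7 - s)] (mod 7)"
    using s(3) by (intro cong_add cong_refl) (simp add: cong_sym)
  also have "s * q + q * (7 - s) = 7 * q" by (simp add: algebra_simps)
  finally have "7 dvd 1 + q * (7 - s)" by (simp add: cong_def mod_eq_0_iff_dvd)
  thus ?thesis by (simp add: U_def)
qed

text \<open>
  Modulo each of 7, \<open>q\<close>, \<open>r\<close> two of the three summands of \<open>F m\<close> vanish, and the third one is \<open>m\<close>.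
\<close>

lemma F_cong: "7 * q * r dvd F m - m"
proof -
  have cop: "coprime q r"
  proof -
    have "coprime q (v * (7 * r))" using v by (metis cong_imp_coprime cong_sym coprime_1_left coprime_commute)
    thus ?thesis by auto
  qed
  have st: "[s * t * (q * r) = 1] (mod 7)"
    using cong_mult[OF s(3) t(3)] by (simp add: mult_ac)
  have "[F m = m * (s * t) * (q * r) + 0 + 0] (mod 7)"
    unfolding F_def X_def by (intro cong_add cong_mult cong_refl) (auto simp: cong_0_iff cong_def)
  also have "[m * (s * t) * (q * r) + 0 + 0 = m * 1] (mod 7)"
    using cong_mult[OF cong_refl[of m] st] by (simp add: mult_ac)
  finally have 1: "[F m = m] (mod 7)" by simp
  have "[F m = 0 + m * v * (7 * r) + 0] (mod q)"
    unfolding F_def Y_def by (intro cong_add cong_mult cong_refl) (auto simp: cong_0_iff cong_def)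
  also have "[0 + m * v * (7 * r) + 0 = m * 1] (mod q)"
    using cong_mult[OF cong_refl[of m] v] by (simp add: mult_ac)
  finally have 2: "[F m = m] (mod q)" by simp
  have "[F m = 0 + 0 + m * w * (7 * q)] (mod r)"
    unfolding F_def Z_def by (intro cong_add cong_mult cong_refl) (auto simp: cong_0_iff cong_def)
  also have "[0 + 0 + m * w * (7 * q) = m * 1] (mod r)"
    using cong_mult[OF cong_refl[of m] w] by (simp add: mult_ac)
  finally have 3: "[F m = m] (mod r)" by simp
  have "7 * q dvd F m - m"
    using 1 2 q by (intro divides_mult) (auto simp: cong_iff_dvd_diff coprime_commute)
  moreover have "r dvd F m - m" using 3 by (simp add: cong_iff_dvd_diff)
  moreover have "coprime (7 * q) r" using cop r by (simp add: coprime_commute)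
  ultimately show ?thesis by (rule divides_mult)
qed

lemma F_eq: "F m = m + 7 * q * r * e m"
  using F_cong[of m] by (simp add: e_def)

lemma X_minus_r: "X (m - r) = (X m - s) mod 7"
proof -
  have "[(m - r) * (s * t) = m * (s * t) - s * (t * r)] (mod 7)" by (simp add: algebra_simps)
  also have "[m * (s * t) - s * (t * r) = X m - s * 1] (mod 7)"
    using t(3) by (intro cong_diff cong_mult cong_refl) (simp_all add: X_def cong_def)
  finally show ?thesis by (simp add: X_def cong_def)
qed

lemma Y_minus_r: "Y (m - r) = (Y m - U) mod q"
proof -
  have "[7 * (v * r) = 7 * U] (mod q)"
    unfolding seven_U using v by (simp add: cong_def mult_ac)
  hence "[v * r = U] (mod q)" using q(2) by (metis cong_mult_lcancel coprime_commute)
  have "[(m - r) * v = m * v - v * r] (mod q)" by (simp add: algebra_simps)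
  also have "[m * v - v * r = Y m - U] (mod q)"
    using \<open>[v * r = U] (mod q)\<close> by (intro cong_diff) (simp_all add: Y_def cong_def)
  finally show ?thesis by (simp add: Y_def cong_def)
qed

lemma Z_minus_r: "Z (m - r) = Z m"
proof -
  have "(m - r) * w = m * w + r * (- w)" by (simp add: algebra_simps)
  thus ?thesis unfolding Z_def by (simp only: mod_mult_self2)
qed

text \<open>
  The shift by \<open>r\<close> lowers the digits modulo 7 and \<open>q\<close> by fixed amounts \<open>s\<close> and \<open>U\<close>, which together
  are worth \<open>r + 7 q r\<close>. So the carry drops by 1, and each digit that wraps around restores 1.
\<close>

lemma e_minus_r: "e (m - r) = e m - 1 + of_bool (X m < s) + of_bool (Y m < U)"
proof -
  have "7 * 0 < 7 * U" unfolding seven_U using q s by (simp add: add_pos_nonneg)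
  have "q * (7 - s) \<le> q * 6" using q s by (intro mult_left_mono) auto
  hence "7 * U \<le> 7 * q" unfolding seven_U using q by linarith
  hence U: "0 \<le> U" "U \<le> q" using \<open>7 * 0 < 7 * U\<close> by auto
  have X': "X (m - r) = X m - s + 7 * of_bool (X m < s)"
    unfolding X_minus_r using X_bounds[of m] s by (intro mod_diff_wrap) auto
  have Y': "Y (m - r) = Y m - U + q * of_bool (Y m < U)"
    unfolding Y_minus_r using Y_bounds[of m] U by (intro mod_diff_wrap) auto
  have "F (m - r) = F m - s * q * r - r * (7 * U) + 7 * q * r * (of_bool (X m < s) + of_bool (Y m < U))"
    unfolding F_def X' Y' Z_minus_r by (simp add: algebra_simps)
  hence "F (m - r) - (m - r) = 7 * q * r * (e m - 1 + of_bool (X m < s) + of_bool (Y m < U))"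
    unfolding seven_U F_eq[of m] by (simp add: algebra_simps)
  thus ?thesis using q r by (simp add: e_def)
qed

end

sublocale two_moduli \<subseteq> swap: two_moduli r q t s w v
  by unfold_locales (use q r s t v w in \<open>simp_all add: mult_ac\<close>)

context two_moduli begin

lemma swap_simps: "swap.X = X" "swap.Y = Z" "swap.Z = Y" "swap.F = F" "swap.e = e"
  by (simp_all add: fun_eq_iff X_def Y_def Z_def F_def e_def swap.X_def swap.Y_def swap.Z_def
     swap.F_def swap.e_def mult_ac add_ac)

lemma X_minus_q: "X (m - q) = (X m - t) mod 7"
  using swap.X_minus_r unfolding swap_simps .

lemma Y_minus_q: "Y (m - q) = Y m"
  using swap.Z_minus_r unfolding swap_simps .

lemma e_minus_q: "e (m - q) = e m - 1 + of_bool (X m < t) + of_bool (Z m < swap.U)"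
  using swap.e_minus_r unfolding swap_simps .

text \<open>
  The integers with digit \<open>x\<close> modulo 7 are those congruent to \<open>x q r\<close>, so this is the position of
  the one in the window below \<open>n\<close>.
\<close>

definition residue_index :: "int \<Rightarrow> int \<Rightarrow> int" where
  "residue_index n x = (n - x * (q * r)) mod 7"

lemma X_residue_index: "x \<in> {0..6} \<Longrightarrow> X (n - residue_index n x) = x"
proof -
  assume x: "x \<in> {0..6}"
  have "[n - residue_index n x = n - (n - x * (q * r))] (mod 7)"
    unfolding residue_index_def by (intro cong_diff cong_refl) (simp add: cong_def)
  hence "[(n - residue_index n x) * (s * t) = (n - (n - x * (q * r))) * (s * t)] (mod 7)"
    by (intro cong_mult cong_refl)
  also have "(n - (n - x * (q * r))) * (s * t) = x * ((s * q) * (t * r))" by (simp add: algebra_simps)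
  also have "[x * ((s * q) * (t * r)) = x * (1 * 1)] (mod 7)"
    by (intro cong_mult cong_refl s t)
  finally show ?thesis using x by (simp add: X_def cong_def)
qed

lemma residue_index_X: "j \<in> {0..6} \<Longrightarrow> residue_index n (X (n - j)) = j"
proof -
  assume j: "j \<in> {0..6}"
  have "[n - X (n - j) * (q * r) = n - (n - j) * (s * t) * (q * r)] (mod 7)"
    unfolding X_def by (intro cong_diff cong_mult cong_refl) (simp add: cong_def)
  also have "n - (n - j) * (s * t) * (q * r) = n - (n - j) * ((s * q) * (t * r))" by (simp add: algebra_simps)
  also have "[n - (n - j) * ((s * q) * (t * r)) = n - (n - j) * (1 * 1)] (mod 7)"
    by (intro cong_diff cong_mult cong_refl s t)
  finally show ?thesis using j by (simp add: residue_index_def cong_def)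
qed

lemma residue_index_bounds: "0 \<le> residue_index n x" "residue_index n x < 7"
  by (auto simp: residue_index_def)

definition rep :: "int \<Rightarrow> int" where "rep m = of_bool (F m = m)"

lemma rep_eq: "rep m = of_bool (e m = 0)"
  using q r by (simp add: rep_def F_eq[of m])

text \<open>
  The window is an instance of the combinatorial core. The scaled digit sum of \<open>n - j\<close> equals the
  carry plus \<open>(n - j) / (7 q r)\<close>, which drifts with the position \<open>j\<close>. Adding \<open>j / (7 q r)\<close> to the
  third coordinate makes the fractional part constant; the perturbation is so small that the
  coordinate stays below 1 and on the same side of its threshold.
\<close>

lemma sum_rep_bound:
  assumes n: "0 \<le> n" "n < 7 * q * r" and le: "s \<le> t"
  shows "\<bar>\<Sum>j=0..6. rep (n - j) - rep (n - j - q) - rep (n - j - r) + rep (n - j - q - r)\<bar> \<le> 4"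
proof -
  define J where "J = residue_index n"
  define \<theta> where "\<theta> = real_of_int n / real_of_int (7 * q * r)"
  define \<delta> where "\<delta> = real_of_int v / real_of_int q"
  define \<epsilon> where "\<epsilon> = real_of_int w / real_of_int r - 1 / (7 * q * r)"
  define E where "E x = e (n - J x)" for x
  define y where "y x = real_of_int (Y (n - J x)) / q" for x
  define z where "z x = (real_of_int (Z (n - J x)) + J x / (7 * q)) / r" for x
  have J: "0 \<le> J x" "J x \<le> 6" for x using residue_index_bounds[of n x] by (auto simp: J_def)
  have pos: "0 < 7 * q * r" using q r by simp
  have drift: "0 \<le> J x / (7 * q)" "J x / (7 * q) < 1 / 7" for x
    using J[of x] q by (simp_all add: field_simps)
  interpret phase_window s t "q * r" n \<theta> \<delta> \<epsilon> E y z
  proof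
    show "1 \<le> s" "s \<le> t" "t \<le> 6" by (fact s t le)+
    have "[s * q * (t * r) = 1] (mod 7)" using cong_mult[OF s(3) t(3)] by simp
    thus "q * r * s * t mod 7 = 1" by (simp add: cong_def mult_ac)
    show "0 \<le> \<theta>" using n q r by (simp add: \<theta>_def)
    have "real_of_int n < real_of_int (7 * q * r)" using n(2) by (simp only: of_int_less_iff)
    moreover have "0 < real_of_int (7 * q * r)" using pos by (simp only: of_int_0_less_iff)
    ultimately show "\<theta> < 1" unfolding \<theta>_def by (simp only: divide_less_eq_1_pos)
    show "0 \<le> y x" "y x < 1" for x
      using Y_bounds[of "n - J x"] q by (simp_all add: y_def)
    show "0 \<le> z x" for x
      using Z_bounds[of "n - J x"] r drift[of x] by (simp add: z_def)
    have "real_of_int (Z (n - J x)) \<le> real_of_int r - 1" for x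
      using Z_bounds[of "n - J x"] by linarith
    hence "real_of_int (Z (n - J x)) + real_of_int (J x) / real_of_int (7 * q) < real_of_int r" for x
      using drift(2)[of x] add_le_less_mono[of "Z (n - J x)" "real_of_int r - 1" "J x / (7 * q)" 1] by force
    thus "z x < 1" for x using r by (simp add: z_def)
    show "y x \<noteq> 1 - s / 7" for x
      using less_threshold_iff(2)[OF seven_U q(2) s(1,2), of 0 "Y (n - J x)"] q by (simp add: y_def)
    show "z x \<noteq> 1 - t / 7" for x
      unfolding z_def by (rule less_threshold_iff(2)[OF swap.seven_U r(2) t(1,2)]) (use r drift[of x] in simp_all)
    show "x / 7 + y x + z x = E x + \<theta>" if "x \<in> {0..6}" for x
    proof -
      have X: "X (n - J x) = x" using X_residue_index[OF that] by (simp add: J_def)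
      have qr: "real_of_int q \<noteq> 0" "real_of_int r \<noteq> 0" using q r by auto
      have "x * (q * r) + Y (n - J x) * (7 * r) + Z (n - J x) * (7 * q) + J x = n + 7 * q * r * E x"
        using F_eq[of "n - J x"] unfolding E_def F_def X by simp
      from arg_cong[OF this, of real_of_int] have eq:
        "real_of_int x * (real_of_int q * real_of_int r) + real_of_int (Y (n - J x)) * (7 * real_of_int r)
          + real_of_int (Z (n - J x)) * (7 * real_of_int q) + real_of_int (J x)
        = real_of_int n + 7 * real_of_int q * real_of_int r * real_of_int (E x)"
        by (simp only: of_int_add of_int_mult of_int_numeral)
      have "x / 7 + y x + z x = (real_of_int n + 7 * real_of_int q * real_of_int r * real_of_int (E x))
          / (7 * real_of_int q * real_of_int r)"
        using sum_of_fractions[OF qr, of x "Y (n - J x)" "Z (n - J x)" "J x"]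
        unfolding eq y_def z_def by simp
      also have "\<dots> = E x + \<theta>" using qr by (simp add: \<theta>_def add_divide_distrib)
      finally show ?thesis .
    qed
    show "y x - y x' + of_int ((n - x * (q * r)) mod 7 - (n - x' * (q * r)) mod 7) * \<delta> \<in> \<int>" for x x'
      using Ints_mod_step[of q n "J x" v "J x'"] q by (simp add: y_def Y_def \<delta>_def J_def residue_index_def)
    show "z x - z x' + of_int ((n - x * (q * r)) mod 7 - (n - x' * (q * r)) mod 7) * \<epsilon> \<in> \<int>" for x x'
    proof -
      have "z x - z x' + of_int (J x - J x') * \<epsilon> =
        (Z (n - J x)) / r - (Z (n - J x')) / r + (J x - J x') * (w / r)"
        using q r by (simp add: z_def \<epsilon>_def field_simps)
      also have "\<dots> \<in> \<int>" unfolding Z_def using r by (intro Ints_mod_step) simp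
      finally show ?thesis by (simp add: J_def residue_index_def)
    qed
  qed
  have "(\<Sum>j=0..6. rep (n - j) - rep (n - j - q) - rep (n - j - r) + rep (n - j - q - r)) = (\<Sum>x=0..6.
    contribution x)"
  proof (rule sum.reindex_bij_witness[where i = J and j = "\<lambda>j. X (n - j)"])
    fix j :: int assume j: "j \<in> {0..6}"
    show "J (X (n - j)) = j" using residue_index_X[OF j] by (simp add: J_def)
    show "X (n - j) \<in> {0..6}" using X_bounds[of "n - j"] by auto
  next
    fix x :: int assume x: "x \<in> {0..6}"
    show "X (n - J x) = x" using X_residue_index[OF x] by (simp add: J_def)
    show "J x \<in> {0..6}" using J[of x] by auto
  next
    fix j :: int assume j: "j \<in> {0..6}"
    define x where "x = X (n - j)"
    have Jx: "J x = j" using residue_index_X[OF j] by (simp add: J_def x_def)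
    have yU: "Y (n - j) < U \<longleftrightarrow> y x < 1 - s / 7"
      using less_threshold_iff(1)[OF seven_U q(2) s(1,2), of 0 "Y (n - J x)"] q by (simp add: y_def Jx)
    have zU: "Z (n - j) < swap.U \<longleftrightarrow> z x < 1 - t / 7"
      unfolding z_def Jx[symmetric]
      by (subst (2) Jx, rule less_threshold_iff(1)[OF swap.seven_U r(2) t(1,2)]) (use r drift[of x] in
        \<open>simp_all add: Jx\<close>)
    show "contribution (X (n - j)) = rep (n - j) - rep (n - j - q) - rep (n - j - r) + rep (n - j - q - r)"
      unfolding rep_eq e_minus_r e_minus_q X_minus_q Y_minus_q contribution_def x_def[symmetric] yU zU E_def Jx
      by (simp add: algebra_simps)
  qed
  thus ?thesis using abs_sum_contribution by simp
qed

end

section \<open>Heights\<close>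

text \<open>
  The combinatorial bound needs \<open>s \<le> t\<close>; exchanging \<open>q\<close> and \<open>r\<close> takes care of the other case.
\<close>

lemma coeff_cyclotomic_poly_7:
  assumes "prime q" "prime r" "7 < q" "7 < r" "q \<noteq> r" "i < 7 * q * r"
  shows "\<exists>k::int. coeff (cyclotomic_poly (7 * q * r)) i = of_int k \<and> \<bar>k\<bar> \<le> 4"
proof -
  have prime7: "prime (7::nat)" by simp
  have inv: "\<exists>s::int. 1 \<le> s \<and> s \<le> 6 \<and> [s * int q = 1] (mod 7)" if "prime q" "7 < q" for q
  proof -
    have "coprime (int q) 7"
      using primes_coprime[of q 7] that by (metis coprime_int_iff nat_neq_iff of_nat_numeral prime7)
    then obtain s where "[int q * s = 1] (mod 7)" using cong_solve_coprime_int by blast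
    hence s: "[(s mod 7) * int q = 1] (mod 7)" by (simp add: cong_def mod_mult_right_eq mult.commute)
    have "s mod 7 \<noteq> 0" using s by (auto simp: cong_def)
    moreover have "0 \<le> s mod 7" "s mod 7 < 7" by auto
    ultimately have "1 \<le> s mod 7" "s mod 7 \<le> 6" by linarith+
    thus ?thesis using s by blast
  qed
  have main: "\<exists>k::int. coeff (cyclotomic_poly (7 * q * r)) i = of_int k \<and> \<bar>k\<bar> \<le> 4"
    if qr: "prime q" "prime r" "7 < q" "7 < r" "q \<noteq> r" "i < 7 * q * r"
      and s: "1 \<le> s" "s \<le> 6" "[s * int q = 1] (mod 7)"
      and t: "1 \<le> t" "t \<le> 6" "[t * int r = 1] (mod 7)" and "s \<le> t" for q r and s t :: int
  proof -
    have cop: "coprime q 7" "coprime r 7" "coprime q r"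
      using qr by (auto intro!: primes_coprime)
    have icop: "coprime (int q) 7" "coprime (int r) 7" "coprime (int q) (int r)"
      using cop coprime_int_iff[of q 7] coprime_int_iff[of r 7] by simp_all
    hence "coprime (7 * int r) (int q)" "coprime (7 * int q) (int r)"
      by (simp_all add: coprime_commute[of 7] coprime_commute[of "int r" "int q"] coprime_commute[of r q])
    then obtain v w where v: "[7 * int r * v = 1] (mod int q)" and w: "[7 * int q * w = 1] (mod int r)"
      using cong_solve_coprime_int by metis
    interpret two_moduli "int q" "int r" s t v w
    proof
      show "coprime (int q) 7" "coprime (int r) 7"
        by (fact icop)+
    qed (use qr s t v w in \<open>simp_all add: mult_ac\<close>)
    have u: "[s * t * (int q * int r) = 1] (mod 7)" using cong_mult[OF s(3) t(3)] by (simp add: mult_ac)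
    have rep: "int (num_reps 7 q r m) = rep m" for m
      using num_reps_eq[of 7 q r "s * t" v w m] qr u v w
      by (simp add: rep_def F_def X_def Y_def Z_def mult_ac)
    let ?f = "\<lambda>j. rep (int i - j) - rep (int i - j - int q) - rep (int i - j - int r) + rep (int i - j - int q
      - int r)"
    have "coeff (cyclotomic_poly (7 * q * r)) i = of_int (\<Sum>j<7. ?f (int j))"
      using coeff_cyclotomic_poly_three_primes[of 7 q r i] qr by (simp add: rep)
    also have "(\<Sum>j<7. ?f (int j)) = (\<Sum>j=0..6. ?f j)"
      by (rule sum.reindex_bij_witness[of _ nat int]) auto
    finally have "coeff (cyclotomic_poly (7 * q * r)) i = of_int (\<Sum>j=0..6. ?f j)" .
    moreover have "\<bar>\<Sum>j=0..6. ?f j\<bar> \<le> 4"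
    proof (rule sum_rep_bound)
      have "int i < int (7 * q * r)" using qr(6) by (simp only: of_nat_less_iff)
      thus "int i < 7 * int q * int r" by simp
    qed (use \<open>s \<le> t\<close> in auto)
    ultimately show ?thesis by blast
  qed
  obtain s :: int where s: "1 \<le> s" "s \<le> 6" "[s * int q = 1] (mod 7)" using inv[OF assms(1,3)] by blast
  obtain t :: int where t: "1 \<le> t" "t \<le> 6" "[t * int r = 1] (mod 7)" using inv[OF assms(2,4)] by blast
  have swap: "7 * r * q = 7 * q * r" by simp
  show ?thesis
  proof (cases "s \<le> t")
    case True
    show ?thesis using main[OF assms s t True] .
  next
    case False
    thus ?thesis using main[of r q t s] assms s t unfolding swap by simp
  qed
qed

text \<open>
  That the height is one of finitely many integers, and not just at most 4, is what makes the set
  of all heights finite.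
\<close>

lemma cyclotomic_height_7:
  assumes "prime q" "prime r" "7 < q" "q < r"
  shows "cyclotomic_height (7 * q * r) \<in> {0, 1, 2, 3, 4}"
proof -
  let ?S = "{cmod (coeff (cyclotomic_poly (7 * q * r)) i) | i. i \<le> totient (7 * q * r)}"
  have "?S = (\<lambda>i. cmod (coeff (cyclotomic_poly (7 * q * r)) i)) ` {..totient (7 * q * r)}" by auto
  hence "finite ?S" "?S \<noteq> {}" by auto
  hence "cyclotomic_height (7 * q * r) \<in> ?S" unfolding cyclotomic_height_def by (rule Max_in)
  then obtain i where i: "cyclotomic_height (7 * q * r) = cmod (coeff (cyclotomic_poly (7 * q * r)) i)"
    "i \<le> totient (7 * q * r)" by blast
  have "1 < q * r" using assms by (intro less_1_mult) auto
  hence "totient (7 * q * r) < 7 * q * r" by (intro totient_less) (simp add: mult.assoc)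
  hence "i < 7 * q * r" using i by simp
  then obtain k :: int where k: "coeff (cyclotomic_poly (7 * q * r)) i = of_int k" "\<bar>k\<bar> \<le> 4"
    using coeff_cyclotomic_poly_7[of q r i] assms by auto
  have "cyclotomic_height (7 * q * r) = of_int \<bar>k\<bar>" using i(1) k(1) by simp
  moreover have "\<bar>k\<bar> \<in> {0, 1, 2, 3, 4}" using k(2) by auto
  ultimately show ?thesis by auto
qed

lemma cyclotomic_height_2737: "cyclotomic_height (7 * 17 * 23) = 4"
proof -
  let ?S = "{cmod (coeff (cyclotomic_poly (7 * 17 * 23)) i) | i. i \<le> totient (7 * 17 * 23)}"
  have fin: "finite ?S" by simp
  have pr: "prime (7::nat)" "prime (17::nat)" "prime (23::nat)" by simp_all
  have cop: "coprime (7::nat) 17" "coprime (7::nat) 23" "coprime (17::nat) 23"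
    by (rule primes_coprime; simp)+
  hence "coprime (7 * 17 :: nat) 23" by (simp only: coprime_mult_left_iff)
  hence "totient (7 * 17 * 23) = 6 * 16 * 22"
    using pr cop by (simp only: totient_mult_coprime totient_prime) simp
  hence "cmod (coeff (cyclotomic_poly (7 * 17 * 23)) 875) \<in> ?S" by force
  hence "cmod (coeff (cyclotomic_poly (7 * 17 * 23)) 875) \<le> cyclotomic_height (7 * 17 * 23)"
    unfolding cyclotomic_height_def by (rule Max_ge[OF fin])
  hence "cyclotomic_height (7 * 17 * 23) \<ge> 4" unfolding coeff_example by simp
  thus ?thesis using cyclotomic_height_7[of 17 23] pr by auto
qed

theorem theorem3p5:
  shows "finite (ternary_heights 7) \<and> max_ternary_height 7 = 4"
proof -
  have sub: "ternary_heights 7 \<subseteq> {0, 1, 2, 3, 4}"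
    unfolding ternary_heights_def using cyclotomic_height_7 by blast
  hence fin: "finite (ternary_heights 7)" by (rule finite_subset) simp
  have "4 \<in> ternary_heights 7"
    unfolding ternary_heights_def
    by (rule CollectI, rule exI[of _ 17], rule exI[of _ 23]) (simp only: cyclotomic_height_2737, simp)
  hence "max_ternary_height 7 = 4"
    unfolding max_ternary_height_def using fin sub by (intro Max_eqI) auto
  thus ?thesis using fin by blast
qed

end
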